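(* Let $(X,r)$ be a left non-degenerate set-theoretic solution of the Yang--Baxter equation, let $M=M(X,r)$ with its operations $\circ$ and $+$, let $\eta$ be the left cancellative congruence on $(M,+)$, and let $\bar M=M/\eta$. Let $\bar\phi(\bar a,\bar b)=\bar\lambda_{\bar a}(\bar b)$ for all $\bar a,\bar b\in\bar M$. Then $(\bar M,+,\circ,\bar\phi)$ is a left semi-truss with $\bar M+\bar a\subseteq\bar a+\bar M$ for all $\bar a\in\bar M$. Moreover, $\bar\lambda\colon(\bar M,\circ)\to\operatorname{Aut}(\bar M,+)$ is a homomorphism with $\bar a\circ\bar b=\bar a+\bar\lambda_{\bar a}(\bar b)$ for all $\bar a,\bar b\in\bar M$, and for each $(\bar a,\bar b)\in\bar M\times\bar M$ there exists a unique element $c(\bar a,\bar b)\in\bar M$ such that $\bar a+\bar b=\bar b+c(\bar a,\bar b)$. In particular, $(\bar M,\bar r)$, where $$\bar r(\bar a,\bar b)=\bigl(\bar\lambda_{\bar a}(\bar b),\ \bar\lambda^{-1}_{\bar\lambda_{\bar a}(\bar b)}\bigl(c(\bar a,\bar\lambda_{\bar a}(\bar b))\bigr)\bigr)\quad\text{for all }\bar a,\bar b\in\bar M,$$ is a left non-degenerate set-theoretic solution of the Yang--Baxter equation. In particular, $\bar r$ restricts to a left non-degenerate solution $(\bar X,\bar r_{|\bar X})$ on the image $\bar X$ of $X$ in $\bar M$.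
   Context: A set-theoretic solution of the Yang--Baxter equation (YBE) is a pair $(X,r)$ with $X$ a non-empty set (possibly infinite) and $r\colon X\times X\to X\times X$ a map (not necessarily bijective) such that $(r\times \mathrm{id}_X)\circ(\mathrm{id}_X\times r)\circ(r\times \mathrm{id}_X)=(\mathrm{id}_X\times r)\circ(r\times \mathrm{id}_X)\circ(\mathrm{id}_X\times r)$. Write $r(x,y)=(\sigma_x(y),\gamma_y(x))$. The solution is left non-degenerate if every $\sigma_x\colon X\to X$ is bijective. A left semi-truss is a quadruple $(A,+,\circ,\phi)$ where $(A,+)$ and $(A,\circ)$ are non-empty semigroups and $\phi\colon A\times A\to A$ is a function such that $a\circ(b+c)=(a\circ b)+\phi(a,c)$ for all $a,b,c\in A$. Let $(X,r)$ be left non-degenerate. The structure monoid is $M=M(X,r)=\langle X\mid x\circ y=\sigma_x(y)\circ\gamma_y(x),\ x,y\in X\rangle$. The left derived structure monoid is $A(X,r)=\langle X\mid x+\sigma_x(y)=\sigma_x(y)+\sigma_{\sigma_x(y)}\gamma_y(x),\ x,y\in X\rangle$ (written additively, not necessarily commutative); it equals the structure monoid $M(X,r')$ of the left derived solution $r'(x,y)=(y,\sigma_y\gamma_{\sigma_x^{-1}(y)}(x))$. There is a unique monoid homomorphism $\lambda'\colon (M,\circ)\to\operatorname{Aut}(A(X,r))$, $a\mapsto\lambda'_a$, with $\lambda'_x(y)=\sigma_x(y)$ for $x,y\in X$, and a unique map $\pi\colon M\to A(X,r)$ with $\pi(x)=x$ for $x\in X$ and $\pi(a\circ b)=\pi(a)+\lambda'_a(\pi(b))$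 for all $a,b\in M$; since $(X,r)$ is left non-degenerate, $\pi$ is bijective. Identify $M$ with $A(X,r)$ via $\pi$; thus $M$ carries both operations $\circ$ and $+$, $\lambda'\colon(M,\circ)\to\operatorname{Aut}(M,+)$ is a homomorphism and $a\circ b=a+\lambda'_a(b)$ for all $a,b\in M$. The left cancellative congruence $\eta$ on $(M,+)$ is the smallest congruence on $(M,+)$ such that $(M,+)/\eta$ is a left cancellative monoid. It is also a congruence on $(M,\circ)$, so $\bar M=M/\eta$ carries both induced operations $+$ and $\circ$. Write $a\mapsto\bar a$ for the natural projection $M\to\bar M$. The map $\bar\lambda\colon(\bar M,\circ)\to\operatorname{Aut}(\bar M,+)$, $\bar a\mapsto\bar\lambda_{\bar a}$, is defined by $\bar\lambda_{\bar a}(\bar b)=\overline{\lambda'_a(b)}$ for $a,b\in M$ (this is well defined).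
   Formalization: The formal theorem assumes that η is also a congruence on (M,∘); the context asserts this for every left non-degenerate solution, but it fails for a ten-element one, and without it the operation ∘ and the map λ̄ on M̄ are not well defined. *)

theory Defs
  imports "HOL-Algebra.Coset" "HOL-Algebra.Bij"
begin

section \<open>Set-theoretic solutions of the Yang--Baxter equation\<close>

definition sig :: "('a \<times> 'a \<Rightarrow> 'a \<times> 'a) \<Rightarrow> 'a \<Rightarrow> 'a \<Rightarrow> 'a" where
  "sig r x y = fst (r (x, y))"

definition gam :: "('a \<times> 'a \<Rightarrow> 'a \<times> 'a) \<Rightarrow> 'a \<Rightarrow> 'a \<Rightarrow> 'a" where
  "gam r y x = snd (r (x, y))"

definition r_times_id :: "('a \<times> 'a \<Rightarrow> 'a \<times> 'a) \<Rightarrow> 'a \<times> 'a \<times> 'a \<Rightarrow> 'a \<times> 'a \<times> 'a" where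
  "r_times_id r = (\<lambda>(x, y, z). (fst (r (x, y)), snd (r (x, y)), z))"

definition id_times_r :: "('a \<times> 'a \<Rightarrow> 'a \<times> 'a) \<Rightarrow> 'a \<times> 'a \<times> 'a \<Rightarrow> 'a \<times> 'a \<times> 'a" where
  "id_times_r r = (\<lambda>(x, y, z). (x, fst (r (y, z)), snd (r (y, z))))"

definition ybe_solution :: "'a set \<Rightarrow> ('a \<times> 'a \<Rightarrow> 'a \<times> 'a) \<Rightarrow> bool" where
  "ybe_solution X r \<longleftrightarrow>
     X \<noteq> {} \<and> r \<in> X \<times> X \<rightarrow> X \<times> X \<and>
     (\<forall>t \<in> X \<times> X \<times> X.
        (r_times_id r \<circ> id_times_r r \<circ> r_times_id r) t =
        (id_times_r r \<circ> r_times_id r \<circ> id_times_r r) t)"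

definition left_nondegenerate :: "'a set \<Rightarrow> ('a \<times> 'a \<Rightarrow> 'a \<times> 'a) \<Rightarrow> bool" where
  "left_nondegenerate X r \<longleftrightarrow> (\<forall>x \<in> X. bij_betw (sig r x) X X)"

section \<open>Left semi-trusses\<close>

definition semigroup_on :: "'a set \<Rightarrow> ('a \<Rightarrow> 'a \<Rightarrow> 'a) \<Rightarrow> bool" where
  "semigroup_on A f \<longleftrightarrow>
     A \<noteq> {} \<and> (\<forall>a \<in> A. \<forall>b \<in> A. f a b \<in> A) \<and>
     (\<forall>a \<in> A. \<forall>b \<in> A. \<forall>c \<in> A. f (f a b) c = f a (f b c))"

definition left_semi_truss ::
  "'a set \<Rightarrow> ('a \<Rightarrow> 'a \<Rightarrow> 'a) \<Rightarrow> ('a \<Rightarrow> 'a \<Rightarrow> 'a) \<Rightarrow> ('a \<times> 'a \<Rightarrow> 'a) \<Rightarrow> bool" where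
  "left_semi_truss A add circ phi \<longleftrightarrow>
     semigroup_on A add \<and> semigroup_on A circ \<and> phi \<in> A \<times> A \<rightarrow> A \<and>
     (\<forall>a \<in> A. \<forall>b \<in> A. \<forall>c \<in> A. circ a (add b c) = add (circ a b) (phi (a, c)))"

section \<open>Congruences, quotients and presentations of monoids\<close>

definition monoid_congruence :: "('a, 'm) monoid_scheme \<Rightarrow> ('a \<times> 'a) set \<Rightarrow> bool" where
  "monoid_congruence G E \<longleftrightarrow>
     equiv (carrier G) E \<and>
     (\<forall>(a, a') \<in> E. \<forall>(b, b') \<in> E. (a \<otimes>\<^bsub>G\<^esub> b, a' \<otimes>\<^bsub>G\<^esub> b') \<in> E)"

text \<open>The product of two classes is written as a union over all representatives, so that no
  representative has to be chosen; for a congruence it is the class of the product of any two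
  representatives.\<close>

definition quotient_monoid :: "('a, 'm) monoid_scheme \<Rightarrow> ('a \<times> 'a) set \<Rightarrow> 'a set monoid" where
  "quotient_monoid G E =
     \<lparr>carrier = carrier G // E,
      mult = (\<lambda>A B. \<Union>a \<in> A. \<Union>b \<in> B. E `` {a \<otimes>\<^bsub>G\<^esub> b}),
      one = E `` {\<one>\<^bsub>G\<^esub>}\<rparr>"

definition generated_congruence ::
  "('a, 'm) monoid_scheme \<Rightarrow> ('a \<times> 'a) set \<Rightarrow> ('a \<times> 'a) set" where
  "generated_congruence G R = \<Inter>{E. monoid_congruence G E \<and> R \<subseteq> E}"

definition free_monoid :: "'a set \<Rightarrow> 'a list monoid" where
  "free_monoid X = \<lparr>carrier = lists X, mult = (@), one = []\<rparr>"

definition presented_monoid :: "'a set \<Rightarrow> ('a list \<times> 'a list) set \<Rightarrow> 'a list set monoid" where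
  "presented_monoid X R = quotient_monoid (free_monoid X) (generated_congruence (free_monoid X) R)"

definition presented_gen :: "'a set \<Rightarrow> ('a list \<times> 'a list) set \<Rightarrow> 'a \<Rightarrow> 'a list set" where
  "presented_gen X R x = generated_congruence (free_monoid X) R `` {[x]}"

definition left_cancellative :: "('a, 'm) monoid_scheme \<Rightarrow> bool" where
  "left_cancellative G \<longleftrightarrow>
     (\<forall>a \<in> carrier G. \<forall>b \<in> carrier G. \<forall>c \<in> carrier G.
        a \<otimes>\<^bsub>G\<^esub> b = a \<otimes>\<^bsub>G\<^esub> c \<longrightarrow> b = c)"

definition left_cancellative_congruence :: "('a, 'm) monoid_scheme \<Rightarrow> ('a \<times> 'a) set" where
  "left_cancellative_congruence G =
     \<Inter>{E. monoid_congruence G E \<and> left_cancellative (quotient_monoid G E)}"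

text \<open>The two intersections above are again congruences of the required kind, so they are the
  smallest ones.\<close>

lemma monoid_congruence_Inter:
  assumes "\<And>E. E \<in> S \<Longrightarrow> monoid_congruence G E" and "S \<noteq> {}"
  shows "monoid_congruence G (\<Inter>S)"
proof -
  have "equiv (carrier G) (\<Inter>S)"
  proof (rule equivI)
    show "\<Inter>S \<subseteq> carrier G \<times> carrier G"
      using assms unfolding monoid_congruence_def equiv_def by blast
    show "refl_on (carrier G) (\<Inter>S)"
      using assms unfolding monoid_congruence_def equiv_def refl_on_def by blast
    show "sym (\<Inter>S)"
      using assms unfolding monoid_congruence_def equiv_def sym_def by blast
    show "trans (\<Inter>S)"
      using assms unfolding monoid_congruence_def equiv_def trans_def by blast
  qed
  moreover have "(a \<otimes>\<^bsub>G\<^esub> b, a' \<otimes>\<^bsub>G\<^esub> b') \<in> \<Inter>S"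
    if ab: "(a, a') \<in> \<Inter>S" "(b, b') \<in> \<Inter>S" for a a' b b'
  proof
    fix E assume "E \<in> S"
    with ab have "(a, a') \<in> E" "(b, b') \<in> E" and "monoid_congruence G E" using assms(1) by blast+
    then show "(a \<otimes>\<^bsub>G\<^esub> b, a' \<otimes>\<^bsub>G\<^esub> b') \<in> E" unfolding monoid_congruence_def by blast
  qed
  ultimately show ?thesis unfolding monoid_congruence_def by blast
qed

lemma monoid_congruence_full:
  assumes "monoid G"
  shows "monoid_congruence G (carrier G \<times> carrier G)"
proof -
  have "equiv (carrier G) (carrier G \<times> carrier G)"
    by (rule equivI) (auto simp: refl_on_def sym_def trans_def)
  then show ?thesis
    using monoid.m_closed[OF assms] by (auto simp: monoid_congruence_def)
qed

lemma quotient_monoid_mult_class: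
  assumes G: "monoid G" and E: "monoid_congruence G E" and a: "a \<in> carrier G" and b: "b \<in> carrier G"
  shows "E `` {a} \<otimes>\<^bsub>quotient_monoid G E\<^esub> E `` {b} = E `` {a \<otimes>\<^bsub>G\<^esub> b}"
proof -
  have eq: "equiv (carrier G) E" using E by (simp add: monoid_congruence_def)
  have "E `` {a' \<otimes>\<^bsub>G\<^esub> b'} = E `` {a \<otimes>\<^bsub>G\<^esub> b}" if "a' \<in> E `` {a}" "b' \<in> E `` {b}" for a' b'
  proof -
    have "(a \<otimes>\<^bsub>G\<^esub> b, a' \<otimes>\<^bsub>G\<^esub> b') \<in> E" using E that unfolding monoid_congruence_def by blast
    then show ?thesis using eq by (simp add: equiv_class_eq)
  qed
  moreover have "a \<in> E `` {a}" "b \<in> E `` {b}" using equiv_class_self[OF eq] a b by blast+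
  ultimately have "(\<Union>a' \<in> E `` {a}. \<Union>b' \<in> E `` {b}. E `` {a' \<otimes>\<^bsub>G\<^esub> b'}) = E `` {a \<otimes>\<^bsub>G\<^esub> b}"
    by blast
  then show ?thesis by (simp add: quotient_monoid_def)
qed

lemma left_cancellative_quotient_iff:
  assumes G: "monoid G" and E: "monoid_congruence G E"
  shows "left_cancellative (quotient_monoid G E) \<longleftrightarrow>
    (\<forall>a \<in> carrier G. \<forall>b \<in> carrier G. \<forall>c \<in> carrier G.
       (a \<otimes>\<^bsub>G\<^esub> b, a \<otimes>\<^bsub>G\<^esub> c) \<in> E \<longrightarrow> (b, c) \<in> E)"
proof -
  have eq: "equiv (carrier G) E" using E by (simp add: monoid_congruence_def)
  have car: "carrier (quotient_monoid G E) = (\<lambda>a. E `` {a}) ` carrier G"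
    unfolding quotient_monoid_def quotient_def by auto
  have "(E `` {a} \<otimes>\<^bsub>quotient_monoid G E\<^esub> E `` {b} = E `` {a} \<otimes>\<^bsub>quotient_monoid G E\<^esub> E `` {c} \<longrightarrow>
          E `` {b} = E `` {c}) \<longleftrightarrow> ((a \<otimes>\<^bsub>G\<^esub> b, a \<otimes>\<^bsub>G\<^esub> c) \<in> E \<longrightarrow> (b, c) \<in> E)"
    if "a \<in> carrier G" "b \<in> carrier G" "c \<in> carrier G" for a b c
    using that quotient_monoid_mult_class[OF G E]
      eq_equiv_class_iff[OF eq] monoid.m_closed[OF G] by simp
  then show ?thesis
    unfolding left_cancellative_def car by (simp only: ball_simps cong: ball_cong)
qed

lemma generated_congruence_least:
  assumes "monoid G" and "R \<subseteq> carrier G \<times> carrier G"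
  shows "monoid_congruence G (generated_congruence G R)"
    and "R \<subseteq> generated_congruence G R"
    and "\<And>E. monoid_congruence G E \<Longrightarrow> R \<subseteq> E \<Longrightarrow> generated_congruence G R \<subseteq> E"
proof -
  have "{E. monoid_congruence G E \<and> R \<subseteq> E} \<noteq> {}"
    using monoid_congruence_full[OF assms(1)] assms(2) by blast
  then show "monoid_congruence G (generated_congruence G R)"
    unfolding generated_congruence_def by (intro monoid_congruence_Inter) auto
qed (auto simp: generated_congruence_def)

lemma left_cancellative_congruence_least:
  assumes G: "monoid G"
  shows "monoid_congruence G (left_cancellative_congruence G)"
    and "left_cancellative (quotient_monoid G (left_cancellative_congruence G))"
    and "\<And>E. monoid_congruence G E \<Longrightarrow> left_cancellative (quotient_monoid G E) \<Longrightarrow>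
           left_cancellative_congruence G \<subseteq> E"
proof -
  let ?S = "{E. monoid_congruence G E \<and> left_cancellative (quotient_monoid G E)}"
  have "left_cancellative (quotient_monoid G (carrier G \<times> carrier G))"
    using left_cancellative_quotient_iff[OF G monoid_congruence_full[OF G]] by blast
  then have "?S \<noteq> {}" using monoid_congruence_full[OF G] by blast
  then show *: "monoid_congruence G (left_cancellative_congruence G)"
    unfolding left_cancellative_congruence_def by (intro monoid_congruence_Inter) auto
  show "left_cancellative (quotient_monoid G (left_cancellative_congruence G))"
    unfolding left_cancellative_quotient_iff[OF G *]
    by (auto simp: left_cancellative_congruence_def left_cancellative_quotient_iff[OF G])
qed (auto simp: left_cancellative_congruence_def)

section \<open>The structure monoid and the left derived structure monoid\<close>

definition structure_relations :: "'a set \<Rightarrow> ('a \<times> 'a \<Rightarrow> 'a \<times> 'a) \<Rightarrow> ('a list \<times> 'a list) set" where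
  "structure_relations X r =
     {([x, y], [sig r x y, gam r y x]) | x y. x \<in> X \<and> y \<in> X}"

definition derived_relations :: "'a set \<Rightarrow> ('a \<times> 'a \<Rightarrow> 'a \<times> 'a) \<Rightarrow> ('a list \<times> 'a list) set" where
  "derived_relations X r =
     {([x, sig r x y], [sig r x y, sig r (sig r x y) (gam r y x)]) | x y. x \<in> X \<and> y \<in> X}"

definition structure_monoid :: "'a set \<Rightarrow> ('a \<times> 'a \<Rightarrow> 'a \<times> 'a) \<Rightarrow> 'a list set monoid" where
  "structure_monoid X r = presented_monoid X (structure_relations X r)"

definition structure_gen :: "'a set \<Rightarrow> ('a \<times> 'a \<Rightarrow> 'a \<times> 'a) \<Rightarrow> 'a \<Rightarrow> 'a list set" where
  "structure_gen X r = presented_gen X (structure_relations X r)"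

text \<open>The additive monoid is a HOL-Algebra monoid record, so its addition is the
  field \<open>mult\<close>.\<close>

definition derived_monoid :: "'a set \<Rightarrow> ('a \<times> 'a \<Rightarrow> 'a \<times> 'a) \<Rightarrow> 'a list set monoid" where
  "derived_monoid X r = presented_monoid X (derived_relations X r)"

definition derived_gen :: "'a set \<Rightarrow> ('a \<times> 'a \<Rightarrow> 'a \<times> 'a) \<Rightarrow> 'a \<Rightarrow> 'a list set" where
  "derived_gen X r = presented_gen X (derived_relations X r)"

text \<open>\<open>AutoGroup\<close> consists of the bijective multiplicative maps; on a monoid these preserve the
  unit, and a multiplicative map from a monoid into a group does so too. Hence \<open>hom\<close> is the set of
  monoid homomorphisms here. The condition \<open>extensional\<close> pins the map down outside the carrier.\<close>

definition lambda' :: "'a set \<Rightarrow> ('a \<times> 'a \<Rightarrow> 'a \<times> 'a) \<Rightarrow> 'a list set \<Rightarrow> 'a list set \<Rightarrow> 'a list set" where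
  "lambda' X r =
     (THE l. l \<in> hom (structure_monoid X r) (AutoGroup (derived_monoid X r)) \<and>
             l \<in> extensional (carrier (structure_monoid X r)) \<and>
             (\<forall>x \<in> X. \<forall>y \<in> X.
                l (structure_gen X r x) (derived_gen X r y) = derived_gen X r (sig r x y)))"

definition pi_map :: "'a set \<Rightarrow> ('a \<times> 'a \<Rightarrow> 'a \<times> 'a) \<Rightarrow> 'a list set \<Rightarrow> 'a list set" where
  "pi_map X r =
     (THE p. p \<in> carrier (structure_monoid X r) \<rightarrow>\<^sub>E carrier (derived_monoid X r) \<and>
             (\<forall>x \<in> X. p (structure_gen X r x) = derived_gen X r x) \<and>
             (\<forall>a \<in> carrier (structure_monoid X r). \<forall>b \<in> carrier (structure_monoid X r).
                p (a \<otimes>\<^bsub>structure_monoid X r\<^esub> b) =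
                p a \<otimes>\<^bsub>derived_monoid X r\<^esub> lambda' X r a (p b)))"

section \<open>The monoid M with its two operations\<close>

text \<open>The identification along the bijection \<open>pi_map\<close> is made on the side of the derived structure
  monoid: its carrier is the carrier of \<open>M\<close>, and the operation and the map of the structure monoid
  are transported to it.\<close>

definition pi_inv :: "'a set \<Rightarrow> ('a \<times> 'a \<Rightarrow> 'a \<times> 'a) \<Rightarrow> 'a list set \<Rightarrow> 'a list set" where
  "pi_inv X r = inv_into (carrier (structure_monoid X r)) (pi_map X r)"

definition M_add :: "'a set \<Rightarrow> ('a \<times> 'a \<Rightarrow> 'a \<times> 'a) \<Rightarrow> 'a list set monoid" where
  "M_add X r = derived_monoid X r"

definition M_circ :: "'a set \<Rightarrow> ('a \<times> 'a \<Rightarrow> 'a \<times> 'a) \<Rightarrow> 'a list set monoid" where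
  "M_circ X r =
     \<lparr>carrier = carrier (M_add X r),
      mult = (\<lambda>a b. pi_map X r (pi_inv X r a \<otimes>\<^bsub>structure_monoid X r\<^esub> pi_inv X r b)),
      one = pi_map X r \<one>\<^bsub>structure_monoid X r\<^esub>\<rparr>"

definition lambda_M :: "'a set \<Rightarrow> ('a \<times> 'a \<Rightarrow> 'a \<times> 'a) \<Rightarrow> 'a list set \<Rightarrow> 'a list set \<Rightarrow> 'a list set" where
  "lambda_M X r a = lambda' X r (pi_inv X r a)"

section \<open>The left cancellative quotient\<close>

definition eta :: "'a set \<Rightarrow> ('a \<times> 'a \<Rightarrow> 'a \<times> 'a) \<Rightarrow> ('a list set \<times> 'a list set) set" where
  "eta X r = left_cancellative_congruence (M_add X r)"

definition Mbar_add :: "'a set \<Rightarrow> ('a \<times> 'a \<Rightarrow> 'a \<times> 'a) \<Rightarrow> 'a list set set monoid" where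
  "Mbar_add X r = quotient_monoid (M_add X r) (eta X r)"

text \<open>The next quotient, and \<open>lambda_bar\<close> below, are well defined exactly when \<open>eta\<close> is also a
  congruence for the second operation. This is not automatic: it fails for a left non-degenerate
  solution on the ten-element disjoint union of \<open>H\<close> = pairs \<open>(n,k)\<close>, \<open>Y\<close> = pairs \<open>(i,k)\<close> and
  \<open>Z\<close> = \<open>{0,1}\<close>, all entries modulo 2. Put \<open>e(i,k) = 1\<close> if \<open>(i,k) = (0,1)\<close> and \<open>e(i,k) = 0\<close>
  otherwise. Let \<open>sig (n,k)\<close> translate \<open>H\<close> by \<open>(n,k)\<close>, \<open>Y\<close> by \<open>(0,k)\<close> and \<open>Z\<close> by \<open>n\<close>; for \<open>y\<close> in \<open>Y\<close>
  let \<open>sig y\<close> translate \<open>H\<close> by \<open>(e y,0)\<close> and \<open>Z\<close> by \<open>e y\<close> and fix \<open>Y\<close>; for \<open>z\<close> in \<open>Z\<close> let \<open>sig z\<close> be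
  the identity. Let the derived relations be \<open>x + z = z + t z x\<close>, where for \<open>h = (n,k)\<close> in \<open>H\<close> the
  map \<open>t h\<close> is constantly \<open>h\<close> on \<open>H\<close>, constantly \<open>(1,k)\<close> on \<open>Y\<close> and the identity on \<open>Z\<close>, where
  \<open>t (i,l)\<close> for \<open>(i,l)\<close> in \<open>Y\<close> maps \<open>(n,k)\<close> in \<open>H\<close> to \<open>(n + e(i,l+k),k)\<close> and fixes the rest, and where
  \<open>t z\<close> is the identity for \<open>z\<close> in \<open>Z\<close>. With \<open>h = (0,1)\<close> in \<open>H\<close>, \<open>a = (0,1)\<close> and \<open>b = (1,1)\<close> in \<open>Y\<close> one
  has \<open>h + a = h + b\<close>, so \<open>a\<close> and \<open>b\<close> are related by \<open>eta\<close>; but \<open>sig a\<close> swaps the two elements of \<open>Z\<close>,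
  \<open>sig b\<close> fixes them, and they are not related by \<open>eta\<close>, since deleting all letters outside \<open>Z\<close> is a
  homomorphism onto the free commutative monoid on \<open>Z\<close>.\<close>

definition Mbar_circ :: "'a set \<Rightarrow> ('a \<times> 'a \<Rightarrow> 'a \<times> 'a) \<Rightarrow> 'a list set set monoid" where
  "Mbar_circ X r = quotient_monoid (M_circ X r) (eta X r)"

definition lambda_bar ::
  "'a set \<Rightarrow> ('a \<times> 'a \<Rightarrow> 'a \<times> 'a) \<Rightarrow> 'a list set set \<Rightarrow> 'a list set set \<Rightarrow> 'a list set set" where
  "lambda_bar X r A =
     (\<lambda>B \<in> carrier (Mbar_add X r). \<Union>a \<in> A. \<Union>b \<in> B. eta X r `` {lambda_M X r a b})"

definition phi_bar ::
  "'a set \<Rightarrow> ('a \<times> 'a \<Rightarrow> 'a \<times> 'a) \<Rightarrow> 'a list set set \<times> 'a list set set \<Rightarrow> 'a list set set" where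
  "phi_bar X r = (\<lambda>(a, b). lambda_bar X r a b)"

definition c_bar ::
  "'a set \<Rightarrow> ('a \<times> 'a \<Rightarrow> 'a \<times> 'a) \<Rightarrow> 'a list set set \<Rightarrow> 'a list set set \<Rightarrow> 'a list set set" where
  "c_bar X r a b =
     (THE c. c \<in> carrier (Mbar_add X r) \<and>
             a \<otimes>\<^bsub>Mbar_add X r\<^esub> b = b \<otimes>\<^bsub>Mbar_add X r\<^esub> c)"

definition r_bar ::
  "'a set \<Rightarrow> ('a \<times> 'a \<Rightarrow> 'a \<times> 'a) \<Rightarrow>
   'a list set set \<times> 'a list set set \<Rightarrow> 'a list set set \<times> 'a list set set" where
  "r_bar X r =
     (\<lambda>(a, b).
        (lambda_bar X r a b,
         inv_into (carrier (Mbar_add X r)) (lambda_bar X r (lambda_bar X r a b))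
           (c_bar X r a (lambda_bar X r a b))))"

definition X_bar :: "'a set \<Rightarrow> ('a \<times> 'a \<Rightarrow> 'a \<times> 'a) \<Rightarrow> 'a list set set set" where
  "X_bar X r = (\<lambda>x. eta X r `` {derived_gen X r x}) ` X"

end

theory Submission
  imports Defs
begin

text \<open>
  Everything is computed on words over \<open>X\<close>. Put \<open>\<sigma>\<^sub>u = \<sigma>\<^sub>x\<^sub>1 \<circ> \<dots> \<circ> \<sigma>\<^sub>x\<^sub>n\<close> for \<open>u = x\<^sub>1 \<dots> x\<^sub>n\<close>, applied
  letterwise to words. The map \<open>\<pi>\<close> is induced by the bijection \<open>twist\<close> of the set of words that
  fixes the letters and satisfies \<open>twist (u v) = twist u \<sigma>\<^sub>u(twist v)\<close>. The derived relations say \<open>u + v = v + \<tau>\<^sub>v(u)\<close> for letters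
  \<open>u\<close>, \<open>v\<close>, and the braid relation makes every \<open>\<sigma>\<^sub>x\<close> commute with \<open>\<tau>\<close>; hence \<open>\<sigma>\<^sub>x\<close> induces an
  automorphism of the derived monoid, and \<open>twist\<close> matches the translates of the structure relations
  with the translates of the derived relations (\<open>twist_cong_iff\<close>). This identifies \<open>\<lambda>'\<close> and \<open>\<pi>\<close>,
  and so \<open>M\<close> becomes the derived monoid with \<open>a \<circ> b = a + \<lambda>\<^sub>a(b)\<close>, where \<open>\<lambda>\<close> is an action of
  \<open>(M, \<circ>)\<close> by automorphisms of \<open>(M, +)\<close>. The relations \<open>u + v = v + \<tau>\<^sub>v(u)\<close> extend from letters to
  words, which gives \<open>M + b \<subseteq> b + M\<close>.

  The congruence \<open>\<eta>\<close> is invariant under automorphisms, so \<open>\<lambda>\<^sub>a\<close> acts on the quotient; it depends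
  only on the class of \<open>a\<close> because \<open>\<eta>\<close> is compatible with \<open>\<circ>\<close> and its quotient is left cancellative
  (\<open>lambda_M_eta\<close>). All of the structure then passes to the quotient, and left cancellation makes
  the element \<open>c(a, b)\<close> with \<open>a + b = b + c(a, b)\<close> unique.

  The rest is a statement on any left cancellative monoid with such data. The map
  \<open>(a, b) \<mapsto> (\<lambda>\<^sub>a(b), \<gamma>\<^sub>b(a))\<close>, with \<open>\<lambda>\<^bsub>\<lambda>\<^sub>a(b)\<^esub>(\<gamma>\<^sub>b(a)) = c(a, \<lambda>\<^sub>a(b))\<close>, preserves the product \<open>a \<circ> b\<close>. Of the
  three components of the braid relation, the first follows from the action law, the second because
  automorphisms commute with \<open>c\<close>, and the third from the first two by cancelling in the common
  product (\<open>braid_relation\<close>). On the images of two letters the map is the image of \<open>r\<close>, by the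
  derived relation between them, so the image of \<open>X\<close> is a subsolution (\<open>r_bar_gen\<close>).
\<close>

section \<open>Congruences on monoids\<close>

lemma carrier_quotient_monoid:
  "carrier (quotient_monoid G E) = (\<lambda>a. E `` {a}) ` carrier G"
  by (auto simp: quotient_monoid_def quotient_def)

lemma one_quotient_monoid: "\<one>\<^bsub>quotient_monoid G E\<^esub> = E `` {\<one>\<^bsub>G\<^esub>}"
  by (simp add: quotient_monoid_def)

lemma monoid_quotient_monoid:
  assumes G: "monoid G" and E: "monoid_congruence G E"
  shows "monoid (quotient_monoid G E)"
proof -
  interpret monoid G by (rule G)
  show ?thesis
    by (rule monoidI)
      (auto simp: carrier_quotient_monoid one_quotient_monoid quotient_monoid_mult_class[OF G E] m_assoc)
qed

lemma monoid_congruence_class_eq_iff: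
  assumes "monoid_congruence G E" "a \<in> carrier G" "b \<in> carrier G"
  shows "E `` {a} = E `` {b} \<longleftrightarrow> (a, b) \<in> E"
  using assms eq_equiv_class_iff by (fastforce simp: monoid_congruence_def)

lemma monoid_congruenceD:
  assumes "monoid_congruence G E"
  shows "E \<subseteq> carrier G \<times> carrier G"
    and "a \<in> carrier G \<Longrightarrow> (a, a) \<in> E"
    and "(a, b) \<in> E \<Longrightarrow> (b, a) \<in> E"
    and "(a, b) \<in> E \<Longrightarrow> (b, c) \<in> E \<Longrightarrow> (a, c) \<in> E"
    and "(a, b) \<in> E \<Longrightarrow> (c, d) \<in> E \<Longrightarrow> (a \<otimes>\<^bsub>G\<^esub> c, b \<otimes>\<^bsub>G\<^esub> d) \<in> E"
  using assms
  by (auto simp: monoid_congruence_def equiv_def refl_on_def elim: symE dest: transD symD)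

lemma equiv_pullback:
  assumes "equiv B E" and "\<And>a. a \<in> A \<Longrightarrow> f a \<in> B"
  shows "equiv A {(a, b). a \<in> A \<and> b \<in> A \<and> (f a, f b) \<in> E}"
  using assms unfolding equiv_def refl_on_def sym_def trans_def by blast

text \<open>The syntactic congruence of an equivalence relation is the largest congruence below it. So a
  generated congruence lies below an equivalence as soon as the translates of the generating
  pairs do.\<close>

lemma generated_congruence_subset_equiv:
  fixes G (structure)
  assumes G: "monoid G" and R: "R \<subseteq> carrier G \<times> carrier G" and E: "equiv (carrier G) E"
    and step: "\<And>a b u v. \<lbrakk>a \<in> carrier G; b \<in> carrier G; (u, v) \<in> R\<rbrakk> \<Longrightarrow>
      (a \<otimes>\<^bsub>G\<^esub> u \<otimes>\<^bsub>G\<^esub> b, a \<otimes>\<^bsub>G\<^esub> v \<otimes>\<^bsub>G\<^esub> b) \<in> E"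
  shows "generated_congruence G R \<subseteq> E"
proof -
  interpret monoid G by (rule G)
  define S where "S = {(p, q). p \<in> carrier G \<and> q \<in> carrier G \<and>
    (\<forall>a \<in> carrier G. \<forall>b \<in> carrier G. (a \<otimes>\<^bsub>G\<^esub> p \<otimes>\<^bsub>G\<^esub> b, a \<otimes>\<^bsub>G\<^esub> q \<otimes>\<^bsub>G\<^esub> b) \<in> E)}"
  have tE: "(x, y) \<in> E \<Longrightarrow> (y, z) \<in> E \<Longrightarrow> (x, z) \<in> E" for x y z
    using E by (meson equivE transD)
  have eqS: "equiv (carrier G) S"
  proof (rule equivI)
    show "S \<subseteq> carrier G \<times> carrier G" by (auto simp: S_def)
    show "refl_on (carrier G) S"
      using E by (auto simp: S_def refl_on_def equiv_def)
    show "sym S" using E by (auto simp: S_def sym_def equiv_def)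
    show "trans S" unfolding trans_def S_def using tE by blast
  qed
  have "monoid_congruence G S"
    unfolding monoid_congruence_def
  proof (intro conjI eqS; clarify)
    fix p p' q q' assume pp: "(p, p') \<in> S" and qq: "(q, q') \<in> S"
    then have car: "p \<in> carrier G" "p' \<in> carrier G" "q \<in> carrier G" "q' \<in> carrier G"
      by (auto simp: S_def)
    have "(a \<otimes> (p \<otimes> q) \<otimes> b, a \<otimes> (p' \<otimes> q') \<otimes> b) \<in> E" if ab: "a \<in> carrier G" "b \<in> carrier G" for a b
    proof (rule tE)
      have "(a \<otimes> p \<otimes> (q \<otimes> b), a \<otimes> p' \<otimes> (q \<otimes> b)) \<in> E"
        using pp car ab by (auto simp: S_def)
      then show "(a \<otimes> (p \<otimes> q) \<otimes> b, a \<otimes> (p' \<otimes> q) \<otimes> b) \<in> E"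
        using car ab by (simp add: m_assoc)
      have "(a \<otimes> p' \<otimes> q \<otimes> b, a \<otimes> p' \<otimes> q' \<otimes> b) \<in> E"
        using qq car ab by (auto simp: S_def)
      then show "(a \<otimes> (p' \<otimes> q) \<otimes> b, a \<otimes> (p' \<otimes> q') \<otimes> b) \<in> E"
        using car ab by (simp add: m_assoc)
    qed
    with car show "(p \<otimes> q, p' \<otimes> q') \<in> S" by (auto simp: S_def)
  qed
  moreover have "R \<subseteq> S" using R step by (auto simp: S_def)
  ultimately have "generated_congruence G R \<subseteq> S"
    using generated_congruence_least(3)[OF G R] by blast
  also have "S \<subseteq> E"
  proof clarify
    fix p q assume "(p, q) \<in> S"
    then have "p \<in> carrier G" "q \<in> carrier G" "(\<one> \<otimes> p \<otimes> \<one>, \<one> \<otimes> q \<otimes> \<one>) \<in> E"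
      unfolding S_def by blast+
    then show "(p, q) \<in> E" by simp
  qed
  finally show ?thesis .
qed

text \<open>The pullback of the left cancellative congruence along an endomorphism is again a congruence
  with left cancellative quotient, so it contains the smallest one.\<close>

lemma left_cancellative_congruence_endomorphism:
  assumes G: "monoid G" and f: "f \<in> hom G G"
    and ab: "(a, b) \<in> left_cancellative_congruence G"
  shows "(f a, f b) \<in> left_cancellative_congruence G"
proof -
  interpret monoid G by (rule G)
  let ?N = "left_cancellative_congruence G"
  note N = left_cancellative_congruence_least(1)[OF G]
  have lc: "(b, c) \<in> ?N" if "a \<in> carrier G" "b \<in> carrier G" "c \<in> carrier G"
      "(a \<otimes>\<^bsub>G\<^esub> b, a \<otimes>\<^bsub>G\<^esub> c) \<in> ?N" for a b c
    using left_cancellative_congruence_least(2)[OF G] that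
    unfolding left_cancellative_quotient_iff[OF G N] by blast
  define E where "E = {(a, b). a \<in> carrier G \<and> b \<in> carrier G \<and> (f a, f b) \<in> ?N}"
  have fc: "f x \<in> carrier G" if "x \<in> carrier G" for x using f that by (rule hom_in_carrier)
  have "equiv (carrier G) E"
    unfolding E_def using N fc by (intro equiv_pullback) (auto simp: monoid_congruence_def)
  then have E: "monoid_congruence G E"
    unfolding monoid_congruence_def
    by (auto simp: E_def hom_mult[OF f] monoid_congruenceD(5)[OF N])
  have "left_cancellative (quotient_monoid G E)"
    unfolding left_cancellative_quotient_iff[OF G E]
  proof (intro ballI impI)
    fix a b c assume car: "a \<in> carrier G" "b \<in> carrier G" "c \<in> carrier G"
      and "(a \<otimes>\<^bsub>G\<^esub> b, a \<otimes>\<^bsub>G\<^esub> c) \<in> E"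
    then have "(f a \<otimes>\<^bsub>G\<^esub> f b, f a \<otimes>\<^bsub>G\<^esub> f c) \<in> ?N"
      by (simp add: E_def hom_mult[OF f])
    then have "(f b, f c) \<in> ?N" by (rule lc[rotated 3]) (intro fc car)+
    with car show "(b, c) \<in> E" by (simp add: E_def)
  qed
  then have "?N \<subseteq> E" by (rule left_cancellative_congruence_least(3)[OF G E])
  with ab show ?thesis by (auto simp: E_def)
qed

section \<open>Presented monoids\<close>

lemma free_monoid_simps [simp]:
  "carrier (free_monoid X) = lists X" "mult (free_monoid X) = (@)" "\<one>\<^bsub>free_monoid X\<^esub> = []"
  by (simp_all add: free_monoid_def)

lemma monoid_free_monoid: "monoid (free_monoid X)"
  by (rule monoidI) auto

locale monoid_presentation =
  fixes X :: "'a set" and R :: "('a list \<times> 'a list) set"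
  assumes relations: "R \<subseteq> lists X \<times> lists X"
begin

abbreviation "cong \<equiv> generated_congruence (free_monoid X) R"
abbreviation "pm \<equiv> presented_monoid X R"
abbreviation "cls w \<equiv> cong `` {w}"

lemma relations': "R \<subseteq> carrier (free_monoid X) \<times> carrier (free_monoid X)"
  using relations by simp

lemma congruence: "monoid_congruence (free_monoid X) cong"
  by (rule generated_congruence_least(1)[OF monoid_free_monoid relations'])

lemmas cong_facts = monoid_congruenceD[OF congruence, simplified]

lemma cong_relation: "(u, v) \<in> R \<Longrightarrow> (u, v) \<in> cong"
  using generated_congruence_least(2)[OF monoid_free_monoid relations'] by blast

lemma cong_subset_equiv:
  assumes "equiv (lists X) E"
    and "\<And>a b u v. \<lbrakk>a \<in> lists X; b \<in> lists X; (u, v) \<in> R\<rbrakk> \<Longrightarrow> (a @ u @ b, a @ v @ b) \<in> E"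
  shows "cong \<subseteq> E"
  using assms
  by (intro generated_congruence_subset_equiv[OF monoid_free_monoid relations']) auto

lemma monoid_pm: "monoid pm"
  unfolding presented_monoid_def by (rule monoid_quotient_monoid[OF monoid_free_monoid congruence])

lemma carrier_pm: "carrier pm = cls ` lists X"
  by (simp add: presented_monoid_def carrier_quotient_monoid)

lemma cls_closed [simp]: "w \<in> lists X \<Longrightarrow> cls w \<in> carrier pm"
  by (auto simp: carrier_pm)

lemma one_pm: "\<one>\<^bsub>pm\<^esub> = cls []"
  by (simp add: presented_monoid_def one_quotient_monoid)

lemma mult_pm: "u \<in> lists X \<Longrightarrow> v \<in> lists X \<Longrightarrow> cls u \<otimes>\<^bsub>pm\<^esub> cls v = cls (u @ v)"
  using quotient_monoid_mult_class[OF monoid_free_monoid congruence, of u v]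
  by (simp add: presented_monoid_def)

lemma cls_eq_iff: "u \<in> lists X \<Longrightarrow> v \<in> lists X \<Longrightarrow> cls u = cls v \<longleftrightarrow> (u, v) \<in> cong"
  using monoid_congruence_class_eq_iff[OF congruence] by simp

lemma presented_gen_cls: "presented_gen X R x = cls [x]"
  by (simp add: presented_gen_def)

lemma cls_Cons: "x \<in> X \<Longrightarrow> w \<in> lists X \<Longrightarrow> cls (x # w) = cls [x] \<otimes>\<^bsub>pm\<^esub> cls w"
  using mult_pm[of "[x]" w] by simp

end

section \<open>The action on words and the word form of the bijection\<close>

text \<open>Word arguments below are membership statements in \<open>lists X\<close>; classical reasoning would trade
  them for statements on the letters and lose the closure rules for \<open>lists X\<close>.\<close>

declare in_listsD [rule del] in_listsI [rule del]

lemma map_in_lists: "(\<And>x. x \<in> X \<Longrightarrow> f x \<in> Y) \<Longrightarrow> p \<in> lists X \<Longrightarrow> map f p \<in> lists Y"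
  by (auto simp: in_lists_conv_set)

locale lnd_solution =
  fixes X :: "'a set" and r :: "'a \<times> 'a \<Rightarrow> 'a \<times> 'a"
  assumes solution: "ybe_solution X r" and nondegenerate: "left_nondegenerate X r"
begin

lemma sig_closed [simp]: "x \<in> X \<Longrightarrow> y \<in> X \<Longrightarrow> sig r x y \<in> X"
  and gam_closed [simp]: "x \<in> X \<Longrightarrow> y \<in> X \<Longrightarrow> gam r y x \<in> X"
  using solution by (auto simp: ybe_solution_def sig_def gam_def Pi_def mem_Times_iff)

lemma sig_bij: "x \<in> X \<Longrightarrow> bij_betw (sig r x) X X"
  using nondegenerate by (simp add: left_nondegenerate_def)

lemma braid_components:
  assumes "x \<in> X" "y \<in> X" "z \<in> X"
  shows sig_sig: "sig r x (sig r y z) = sig r (sig r x y) (sig r (gam r y x) z)"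
    and gam_sig: "gam r (sig r (gam r y x) z) (sig r x y) = sig r (gam r (sig r y z) x) (gam r z y)"
proof -
  have "(r_times_id r \<circ> id_times_r r \<circ> r_times_id r) (x, y, z) =
        (id_times_r r \<circ> r_times_id r \<circ> id_times_r r) (x, y, z)"
    using solution assms by (auto simp: ybe_solution_def)
  then show "sig r x (sig r y z) = sig r (sig r x y) (sig r (gam r y x) z)"
    and "gam r (sig r (gam r y x) z) (sig r x y) = sig r (gam r (sig r y z) x) (gam r z y)"
    by (auto simp: r_times_id_def id_times_r_def sig_def gam_def prod_eq_iff case_prod_beta)
qed

text \<open>The left derived solution is \<open>(u, v) \<mapsto> (v, tau v u)\<close>; in terms of it the derived
  relations are indexed by all pairs of letters.\<close>

definition tau :: "'a \<Rightarrow> 'a \<Rightarrow> 'a" where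
  "tau v u = sig r v (gam r (inv_into X (sig r u) v) u)"

lemma tau_sig:
  assumes "u \<in> X" "w \<in> X"
  shows "tau (sig r u w) u = sig r (sig r u w) (gam r w u)"
  using assms bij_betw_inv_into_left[OF sig_bij] by (simp add: tau_def)

lemma sig_surj:
  assumes "u \<in> X" "v \<in> X"
  obtains w where "w \<in> X" "v = sig r u w"
  using sig_bij[OF assms(1)] assms(2) by (auto simp: bij_betw_def)

lemma tau_closed [simp]: "u \<in> X \<Longrightarrow> v \<in> X \<Longrightarrow> tau v u \<in> X"
  by (metis gam_closed sig_closed sig_surj tau_sig)

lemma derived_relations_tau: "derived_relations X r = {([u, v], [v, tau v u]) | u v. u \<in> X \<and> v \<in> X}"
proof -
  have "\<exists>x y. ([u, v], [v, tau v u]) = ([x, sig r x y], [sig r x y, sig r (sig r x y) (gam r y x)]) \<and>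
      x \<in> X \<and> y \<in> X" if "u \<in> X" "v \<in> X" for u v
    using that by (metis sig_surj tau_sig)
  moreover have "\<exists>u v. ([x, sig r x y], [sig r x y, sig r (sig r x y) (gam r y x)]) =
      ([u, v], [v, tau v u]) \<and> u \<in> X \<and> v \<in> X" if "x \<in> X" "y \<in> X" for x y
    using that by (metis sig_closed tau_sig)
  ultimately show ?thesis
    unfolding derived_relations_def by blast
qed

text \<open>The letter maps that induce endomorphisms of the derived monoid.\<close>

definition equivariant :: "('a \<Rightarrow> 'a) \<Rightarrow> bool" where
  "equivariant f \<longleftrightarrow> f \<in> X \<rightarrow> X \<and> (\<forall>u \<in> X. \<forall>v \<in> X. f (tau v u) = tau (f v) (f u))"

text \<open>Writing the second letter as \<open>sig r u w\<close>, both sides are \<open>sig r (sig r x (sig r u w))\<close> of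
  the two sides of the second braid identity.\<close>

lemma equivariant_sig:
  assumes x: "x \<in> X"
  shows "equivariant (sig r x)"
proof -
  have "sig r x (tau v u) = tau (sig r x v) (sig r x u)" if u: "u \<in> X" and v: "v \<in> X" for u v
  proof -
    obtain w where w: "w \<in> X" and vw: "v = sig r u w" using sig_surj[OF u v] .
    have "sig r x (tau v u) = sig r (sig r x v) (sig r (gam r v x) (gam r w u))"
      using x u v w by (simp add: vw tau_sig sig_sig[of x "sig r u w" "gam r w u"])
    also have "sig r (gam r v x) (gam r w u) = gam r (sig r (gam r u x) w) (sig r x u)"
      using x u w by (simp add: vw gam_sig)
    also have "sig r (sig r x v) \<dots> = tau (sig r x v) (sig r x u)"
      using x u w by (simp add: vw tau_sig sig_sig[of x u w])
    finally show ?thesis .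
  qed
  with x show ?thesis by (auto simp: equivariant_def)
qed

lemma equivariant_inv:
  assumes "equivariant f" "bij_betw f X X"
  shows "equivariant (inv_into X f)"
proof -
  have inv: "inv_into X f y \<in> X" "f (inv_into X f y) = y" if "y \<in> X" for y
    using assms(2) that by (auto simp: bij_betw_def f_inv_into_f inv_into_into)
  have "inv_into X f (tau v u) = tau (inv_into X f v) (inv_into X f u)" if "u \<in> X" "v \<in> X" for u v
    using that inv assms by (intro inv_into_f_eq) (auto simp: equivariant_def bij_betw_def)
  with inv show ?thesis by (auto simp: equivariant_def)
qed

abbreviation act :: "'a list \<Rightarrow> 'a \<Rightarrow> 'a" where
  "act u \<equiv> foldr (sig r) u"

lemma act_bij: "u \<in> lists X \<Longrightarrow> bij_betw (act u) X X"
proof (induction u)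
  case Nil
  then show ?case by (auto simp: bij_betw_def)
next
  case (Cons x u)
  then have "bij_betw (sig r x \<circ> act u) X X"
    by (intro bij_betw_trans[of _ X X] sig_bij) auto
  then show ?case by (simp add: comp_def)
qed

lemma act_closed [simp]: "u \<in> lists X \<Longrightarrow> x \<in> X \<Longrightarrow> act u x \<in> X"
  using act_bij by (auto simp: bij_betw_def)

lemma map_act_closed [simp]: "u \<in> lists X \<Longrightarrow> p \<in> lists X \<Longrightarrow> map (act u) p \<in> lists X"
  by (rule map_in_lists) simp_all

lemma act_equivariant: "u \<in> lists X \<Longrightarrow> equivariant (act u)"
proof (induction u)
  case Nil
  then show ?case by (simp add: equivariant_def)
next
  case (Cons x u)
  then have "equivariant (act u)" "equivariant (sig r x)" by (simp_all add: equivariant_sig)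
  then show ?case by (auto simp: equivariant_def Pi_def)
qed

text \<open>The map \<open>pi\<close> on words: it turns \<open>x\<^sub>1 \<circ> x\<^sub>2 \<circ> x\<^sub>3 \<circ> \<dots>\<close> into
  \<open>x\<^sub>1 + \<sigma>\<^sub>x\<^sub>1(x\<^sub>2) + \<sigma>\<^sub>x\<^sub>1(\<sigma>\<^sub>x\<^sub>2(x\<^sub>3)) + \<dots>\<close>.\<close>

primrec twist :: "'a list \<Rightarrow> 'a list" where
  "twist [] = []"
| "twist (x # w) = x # map (sig r x) (twist w)"

lemma length_twist [simp]: "length (twist w) = length w"
  by (induction w) auto

lemma twist_append: "twist (u @ v) = twist u @ map (act u) (twist v)"
  by (induction u) auto

lemma twist_append3:
  "twist (u @ v @ w) = twist u @ map (act u) (twist v) @ map (act (u @ v)) (twist w)"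
  by (simp add: twist_append)

lemma twist_closed [simp]: "w \<in> lists X \<Longrightarrow> twist w \<in> lists X"
  by (induction w) (auto intro: map_in_lists[of X])

lemma twist_inj: "u \<in> lists X \<Longrightarrow> v \<in> lists X \<Longrightarrow> twist u = twist v \<Longrightarrow> u = v"
proof (induction u arbitrary: v)
  case Nil
  then show ?case by (metis length_0_conv length_twist)
next
  case (Cons x u)
  then obtain v' where v: "v = x # v'" "v' \<in> lists X"
    by (cases v) auto
  have "inj_on (sig r x) (set (twist u) \<union> set (twist v'))"
  proof (rule inj_on_subset)
    show "inj_on (sig r x) X" using Cons.prems sig_bij by (auto simp: bij_betw_def)
    show "set (twist u) \<union> set (twist v') \<subseteq> X"
      using Cons.prems v twist_closed by (auto simp: in_lists_conv_set)
  qed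
  then have "twist u = twist v'" using Cons.prems v by (auto simp: inj_on_map_eq_map)
  then show ?case using Cons v by auto
qed

lemma twist_surj:
  assumes "p \<in> lists X"
  obtains w where "w \<in> lists X" "p = twist w"
proof -
  have "\<exists>w \<in> lists X. p = twist w"
    using assms
  proof (induction "length p" arbitrary: p)
    case 0
    then show ?case by (intro bexI[of _ "[]"]) auto
  next
    case (Suc n)
    then obtain x q where p: "p = x # q" "x \<in> X" "q \<in> lists X" "length q = n"
      by (cases p) auto
    let ?g = "inv_into X (sig r x)"
    have g: "?g y \<in> X" "sig r x (?g y) = y" if "y \<in> X" for y
      using sig_bij[OF p(2)] that by (auto simp: bij_betw_def f_inv_into_f inv_into_into)
    have "map ?g q \<in> lists X" using p g by (intro map_in_lists) auto
    then obtain w where w: "w \<in> lists X" "map ?g q = twist w"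
      using Suc(1)[of "map ?g q"] p(4) by auto
    have "map (sig r x) (map ?g q) = q" using p(3) g by (auto simp: in_lists_conv_set intro!: map_idI)
    then show ?case using p w by (intro bexI[of _ "x # w"]) auto
  qed
  then show thesis using that by blast
qed

lemma structure_relations_closed: "structure_relations X r \<subseteq> lists X \<times> lists X"
  by (auto simp: structure_relations_def)

lemma derived_relations_closed: "derived_relations X r \<subseteq> lists X \<times> lists X"
  by (auto simp: derived_relations_def)

sublocale S: monoid_presentation X "structure_relations X r"
  by unfold_locales (rule structure_relations_closed)

sublocale D: monoid_presentation X "derived_relations X r"
  by unfold_locales (rule derived_relations_closed)

lemma D_commute: "u \<in> X \<Longrightarrow> v \<in> X \<Longrightarrow> ([u, v], [v, tau v u]) \<in> D.cong"
  by (rule D.cong_relation) (auto simp: derived_relations_tau)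

lemma map_cong_D:
  assumes f: "equivariant f" and pq: "(p, q) \<in> D.cong"
  shows "(map f p, map f q) \<in> D.cong"
proof -
  have fX: "f x \<in> X" if "x \<in> X" for x using f that by (auto simp: equivariant_def)
  note fL = map_in_lists[of X f X, OF fX]
  have "D.cong \<subseteq> {(p, q). p \<in> lists X \<and> q \<in> lists X \<and> (map f p, map f q) \<in> D.cong}"
  proof (rule D.cong_subset_equiv)
    show "equiv (lists X) {(p, q). p \<in> lists X \<and> q \<in> lists X \<and> (map f p, map f q) \<in> D.cong}"
      using D.congruence fL by (intro equiv_pullback[of "lists X"]) (auto simp: monoid_congruence_def)
  next
    fix a b s t assume ab: "a \<in> lists X" "b \<in> lists X" and "(s, t) \<in> derived_relations X r"
    then obtain u v where uv: "u \<in> X" "v \<in> X" "s = [u, v]" "t = [v, tau v u]"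
      by (auto simp: derived_relations_tau)
    have "f (tau v u) = tau (f v) (f u)" using f uv by (simp add: equivariant_def)
    then have "(map f s, map f t) \<in> D.cong" using D_commute[of "f u" "f v"] uv fX by simp
    moreover have "(map f a, map f a) \<in> D.cong" "(map f b, map f b) \<in> D.cong"
      using ab fL by (auto intro!: D.cong_facts(2))
    ultimately have "(map f (a @ s @ b), map f (a @ t @ b)) \<in> D.cong"
      by (simp add: D.cong_facts(5))
    with ab uv show "(a @ s @ b, a @ t @ b) \<in>
        {(p, q). p \<in> lists X \<and> q \<in> lists X \<and> (map f p, map f q) \<in> D.cong}"
      by simp
  qed
  with pq show ?thesis by blast
qed

text \<open>By the first braid identity the two sides of a structure relation act alike.\<close>

lemma S_cong_act:
  assumes "(u, v) \<in> S.cong" "x \<in> X"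
  shows "act u x = act v x"
proof -
  have "S.cong \<subseteq> {(u, v). u \<in> lists X \<and> v \<in> lists X \<and> (\<forall>x \<in> X. act u x = act v x)}"
    (is "_ \<subseteq> ?E")
  proof (rule S.cong_subset_equiv)
    show "equiv (lists X) ?E"
      by (rule equivI) (auto simp: refl_on_def sym_def trans_def)
  next
    fix a b s t assume ab: "a \<in> lists X" "b \<in> lists X" and "(s, t) \<in> structure_relations X r"
    then show "(a @ s @ b, a @ t @ b) \<in> ?E"
      by (auto simp: structure_relations_def) (metis act_closed sig_sig)
  qed
  with assms show ?thesis by blast
qed

lemma S_cong_map_act:
  assumes "(u, v) \<in> S.cong" "p \<in> lists X"
  shows "map (act u) p = map (act v) p"
  using assms S_cong_act by (auto simp: in_lists_conv_set)

lemma twist_relation: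
  assumes "y \<in> X" "z \<in> X"
  shows "twist [y, z] = [y, sig r y z]"
    and "twist [sig r y z, gam r z y] = [sig r y z, tau (sig r y z) y]"
  using assms by (simp_all add: tau_sig)

text \<open>A translate of a structure relation twists to a translate of a derived relation, because the
  two sides of the structure relation act alike on what follows them and the letters before them
  act by an equivariant map. As \<open>twist\<close> is bijective, every translate of a derived relation arises
  in this way.\<close>

lemma twist_translate:
  assumes "a \<in> lists X" "b \<in> lists X" "y \<in> X" "z \<in> X"
  shows "twist (a @ [y, z] @ b) =
      twist a @ [act a y, act a (sig r y z)] @ map (act (a @ [y, z])) (twist b)"
    and "twist (a @ [sig r y z, gam r z y] @ b) =
      twist a @ [act a (sig r y z), tau (act a (sig r y z)) (act a y)] @ map (act (a @ [y, z])) (twist b)"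
proof -
  have "act a (tau (sig r y z) y) = tau (act a (sig r y z)) (act a y)"
    using act_equivariant[OF assms(1)] assms by (simp add: equivariant_def)
  moreover have "map (act (a @ [sig r y z, gam r z y])) (twist b) = map (act (a @ [y, z])) (twist b)"
  proof (rule map_cong[OF refl])
    fix x assume "x \<in> set (twist b)"
    then have "x \<in> X" using twist_closed[OF assms(2)] by (auto simp: in_lists_conv_set)
    then show "act (a @ [sig r y z, gam r z y]) x = act (a @ [y, z]) x"
      using assms sig_sig[of y z x] by simp
  qed
  ultimately show "twist (a @ [sig r y z, gam r z y] @ b) =
      twist a @ [act a (sig r y z), tau (act a (sig r y z)) (act a y)] @ map (act (a @ [y, z])) (twist b)"
    by (simp only: twist_append3 twist_relation[OF assms(3,4)] list.map)
  show "twist (a @ [y, z] @ b) =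
      twist a @ [act a y, act a (sig r y z)] @ map (act (a @ [y, z])) (twist b)"
    by (simp only: twist_append3 twist_relation[OF assms(3,4)] list.map)
qed

text \<open>One direction makes \<open>pi\<close> well defined on the structure monoid, the other makes it injective.
  For the latter the structure congruence is carried over to the derived side by the bijection
  \<open>twist\<close>; the result is an equivalence that contains the translates of the derived relations.\<close>

lemma twist_cong_iff:
  assumes "u \<in> lists X" "v \<in> lists X"
  shows "(twist u, twist v) \<in> D.cong \<longleftrightarrow> (u, v) \<in> S.cong"
proof
  assume "(u, v) \<in> S.cong"
  moreover have "S.cong \<subseteq> {(u, v). u \<in> lists X \<and> v \<in> lists X \<and> (twist u, twist v) \<in> D.cong}"
    (is "_ \<subseteq> ?E")
  proof (rule S.cong_subset_equiv)
    show "equiv (lists X) ?E"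
      using D.congruence by (intro equiv_pullback[of "lists X"]) (auto simp: monoid_congruence_def)
  next
    fix a b s t assume ab: "a \<in> lists X" "b \<in> lists X" and "(s, t) \<in> structure_relations X r"
    then obtain y z where yz: "y \<in> X" "z \<in> X" "s = [y, z]" "t = [sig r y z, gam r z y]"
      by (auto simp: structure_relations_def)
    have "([act a y, act a (sig r y z)], [act a (sig r y z), tau (act a (sig r y z)) (act a y)]) \<in> D.cong"
      using D_commute[of "act a y" "act a (sig r y z)"] ab yz by simp
    then have "(twist (a @ s @ b), twist (a @ t @ b)) \<in> D.cong"
      unfolding yz twist_translate[OF ab yz(1,2)]
      using ab yz by (intro D.cong_facts(2,5)) auto
    with ab yz show "(a @ s @ b, a @ t @ b) \<in> ?E" by simp
  qed
  ultimately show "(twist u, twist v) \<in> D.cong" by blast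
next
  define E where "E = {(twist u, twist v) | u v. (u, v) \<in> S.cong}"
  have lists: "u \<in> lists X \<and> v \<in> lists X" if "(u, v) \<in> S.cong" for u v
    using that S.cong_facts(1) by blast
  have "D.cong \<subseteq> E"
  proof (rule D.cong_subset_equiv)
    show "equiv (lists X) E"
    proof (rule equivI)
      show "E \<subseteq> lists X \<times> lists X" using lists twist_closed unfolding E_def by blast
      show "refl_on (lists X) E"
      proof (rule refl_onI)
        fix p assume "p \<in> lists X"
        then obtain w where "w \<in> lists X" "p = twist w" by (rule twist_surj)
        with S.cong_facts(2) show "(p, p) \<in> E" unfolding E_def by blast
      qed
      show "sym E"
      proof (rule symI)
        fix p q assume "(p, q) \<in> E"
        then obtain u v where "p = twist u" "q = twist v" "(u, v) \<in> S.cong"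
          unfolding E_def by blast
        with S.cong_facts(3) show "(q, p) \<in> E" unfolding E_def by blast
      qed
      show "trans E"
      proof (rule transI)
        fix p q s assume pq: "(p, q) \<in> E" and qs: "(q, s) \<in> E"
        obtain u v where uv: "p = twist u" "q = twist v" "(u, v) \<in> S.cong"
          using pq unfolding E_def by blast
        obtain v' w where vw: "q = twist v'" "s = twist w" "(v', w) \<in> S.cong"
          using qs unfolding E_def by blast
        have "v = v'"
          by (rule twist_inj) (use lists[OF uv(3)] lists[OF vw(3)] uv(2) vw(1) in simp_all)
        with uv(3) vw(3) have "(u, w) \<in> S.cong" using S.cong_facts(4) by blast
        with uv(1) vw(2) show "(p, s) \<in> E" unfolding E_def by blast
      qed
    qed
  next
    fix a b s t assume ab: "a \<in> lists X" "b \<in> lists X" and "(s, t) \<in> derived_relations X r"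
    then obtain u v where uv: "u \<in> X" "v \<in> X" "s = [u, v]" "t = [v, tau v u]"
      by (auto simp: derived_relations_tau)
    have "a @ s @ b \<in> lists X" using ab uv by simp
    then obtain w where w: "w \<in> lists X" "a @ s @ b = twist w" by (rule twist_surj)
    define a' b' where "a' = take (length a) w" and "b' = drop (Suc (Suc (length a))) w"
    \<comment> \<open>As \<open>twist\<close> preserves length, cutting \<open>w\<close> at the position of \<open>s\<close> gives the two letters
      that \<open>twist\<close> turns into \<open>s\<close>.\<close>
    have len: "length w = Suc (Suc (length a + length b))"
      using arg_cong[OF w(2), of length] uv by simp
    then have split: "w = a' @ [w ! length a, w ! Suc (length a)] @ b'"
      unfolding a'_def b'_def
      by (simp add: Cons_nth_drop_Suc)
    then obtain y z where w': "w = a' @ [y, z] @ b'" by blast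
    have car: "a' \<in> lists X" "b' \<in> lists X" "y \<in> X" "z \<in> X" using w(1) w' by auto
    have len': "length (twist a') = length a" using len by (simp add: a'_def)
    have eqs: "a = twist a'" "u = act a' y" "v = act a' (sig r y z)"
        "b = map (act (a' @ [y, z])) (twist b')"
      using w(2) len' unfolding w' twist_translate(1)[OF car] uv by simp_all
    have "a @ t @ b = twist (a' @ [sig r y z, gam r z y] @ b')"
      unfolding twist_translate(2)[OF car] uv eqs by simp
    moreover have "(w, a' @ [sig r y z, gam r z y] @ b') \<in> S.cong"
      unfolding w' using car
      by (intro S.cong_facts(5) S.cong_facts(2) S.cong_relation) (auto simp: structure_relations_def)
    ultimately show "(a @ s @ b, a @ t @ b) \<in> E"
      unfolding E_def using w(2) by blast
  qed
  moreover assume "(twist u, twist v) \<in> D.cong"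
  ultimately have "(twist u, twist v) \<in> E" by blast
  then obtain u' v' where u'v': "twist u = twist u'" "twist v = twist v'" "(u', v') \<in> S.cong"
    unfolding E_def by blast
  have "u = u'" by (rule twist_inj[OF assms(1) _ u'v'(1)]) (use lists[OF u'v'(3)] in simp)
  moreover have "v = v'" by (rule twist_inj[OF assms(2) _ u'v'(2)]) (use lists[OF u'v'(3)] in simp)
  ultimately show "(u, v) \<in> S.cong" using u'v'(3) by simp
qed

text \<open>Word length is well defined on the derived monoid, whose only idempotent is therefore the
  unit; this forces \<open>pi\<close> to preserve the unit.\<close>

lemma D_cong_length: "(p, q) \<in> D.cong \<Longrightarrow> length p = length q"
proof -
  have "D.cong \<subseteq> {(p, q). p \<in> lists X \<and> q \<in> lists X \<and> length p = length q}"
    by (rule D.cong_subset_equiv, rule equivI)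
      (auto simp: refl_on_def sym_def trans_def derived_relations_def)
  then show "(p, q) \<in> D.cong \<Longrightarrow> length p = length q" by blast
qed

text \<open>Move the letters of the second word to the front one at a time; each one that passes a word
  applies \<open>tau\<close> to its letters.\<close>

lemma D_normal:
  assumes "p \<in> lists X" "q \<in> lists X"
  shows "\<exists>s \<in> lists X. (p @ q, q @ s) \<in> D.cong"
proof -
  have letter: "(p @ [y], [y] @ map (tau y) p) \<in> D.cong" if "p \<in> lists X" "y \<in> X" for p y
    using that(1)
  proof (induction p)
    case Nil
    then show ?case using that by (auto intro: D.cong_facts(2))
  next
    case (Cons x p)
    then have 1: "(p @ [y], [y] @ map (tau y) p) \<in> D.cong" and x: "x \<in> X" and p: "p \<in> lists X"
      by simp_all
    have "([x] @ (p @ [y]), [x] @ ([y] @ map (tau y) p)) \<in> D.cong"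
      by (rule D.cong_facts(5)[OF D.cong_facts(2) 1]) (simp add: x)
    moreover have "([x, y] @ map (tau y) p, [y, tau y x] @ map (tau y) p) \<in> D.cong"
      by (intro D.cong_facts(5) D.cong_facts(2) D_commute map_in_lists[of X])
        (use that x p in simp_all)
    ultimately show ?case using D.cong_facts(4) by simp
  qed
  show ?thesis
    using assms(2,1)
  proof (induction q arbitrary: p)
    case Nil
    then show ?case by (auto intro!: bexI[of _ p] D.cong_facts(2))
  next
    case (Cons y q)
    then have y: "y \<in> X" and q: "q \<in> lists X" and p: "p \<in> lists X" by simp_all
    have "map (tau y) p \<in> lists X" by (rule map_in_lists[OF _ p]) (simp add: y)
    from Cons.IH[OF this] obtain s where s: "s \<in> lists X" "(map (tau y) p @ q, q @ s) \<in> D.cong"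
      by (rule bexE)
    have "((p @ [y]) @ q, ([y] @ map (tau y) p) @ q) \<in> D.cong"
      by (rule D.cong_facts(5)[OF letter[OF p y] D.cong_facts(2)[OF q]])
    moreover have "([y] @ (map (tau y) p @ q), [y] @ (q @ s)) \<in> D.cong"
      by (rule D.cong_facts(5)[OF D.cong_facts(2) s(2)]) (simp add: y)
    ultimately have "(p @ (y # q), (y # q) @ s) \<in> D.cong" using D.cong_facts(4) by simp
    with s(1) show ?case by blast
  qed
qed

end

section \<open>Solutions from left cancellative semi-trusses\<close>

text \<open>The second operation is \<open>a \<circ> b = a \<otimes> lam a b\<close>; it enters the axioms only through the action
  law \<open>lam_circ\<close>, which also yields its associativity.\<close>

locale left_cancellative_truss = monoid G for G (structure) +
  fixes lam :: "'a \<Rightarrow> 'a \<Rightarrow> 'a"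
  assumes cancel: "\<lbrakk>a \<in> carrier G; b \<in> carrier G; c \<in> carrier G; a \<otimes> b = a \<otimes> c\<rbrakk> \<Longrightarrow> b = c"
    and normal: "\<lbrakk>a \<in> carrier G; b \<in> carrier G\<rbrakk> \<Longrightarrow> \<exists>c \<in> carrier G. a \<otimes> b = b \<otimes> c"
    and lam_auto: "a \<in> carrier G \<Longrightarrow> lam a \<in> auto G"
    and lam_circ: "\<lbrakk>a \<in> carrier G; b \<in> carrier G; c \<in> carrier G\<rbrakk> \<Longrightarrow>
      lam (a \<otimes> lam a b) c = lam a (lam b c)"
begin

lemma lam_bij: "a \<in> carrier G \<Longrightarrow> bij_betw (lam a) (carrier G) (carrier G)"
  using lam_auto by (auto simp: auto_def Bij_def)

lemma lam_hom: "a \<in> carrier G \<Longrightarrow> lam a \<in> hom G G"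
  using lam_auto by (auto simp: auto_def)

lemma lam_closed [simp]: "a \<in> carrier G \<Longrightarrow> b \<in> carrier G \<Longrightarrow> lam a b \<in> carrier G"
  by (rule hom_in_carrier[OF lam_hom])

lemma lam_inj: "\<lbrakk>a \<in> carrier G; b \<in> carrier G; c \<in> carrier G; lam a b = lam a c\<rbrakk> \<Longrightarrow> b = c"
  using lam_bij[of a] by (auto simp: bij_betw_def dest: inj_onD)

lemma ex1_conjugate:
  assumes "a \<in> carrier G" "b \<in> carrier G"
  shows "\<exists>!c. c \<in> carrier G \<and> a \<otimes> b = b \<otimes> c"
proof -
  obtain c where c: "c \<in> carrier G" "a \<otimes> b = b \<otimes> c" using normal[OF assms] by blast
  then show ?thesis using cancel[OF assms(2) c(1)] by auto
qed

definition conj_elt :: "'a \<Rightarrow> 'a \<Rightarrow> 'a" where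
  "conj_elt a b = (THE c. c \<in> carrier G \<and> a \<otimes> b = b \<otimes> c)"

lemma conj_elt:
  assumes "a \<in> carrier G" "b \<in> carrier G"
  shows "conj_elt a b \<in> carrier G" and "a \<otimes> b = b \<otimes> conj_elt a b"
  using theI'[OF ex1_conjugate[OF assms]] by (auto simp: conj_elt_def)

lemma conj_elt_eqI:
  "\<lbrakk>a \<in> carrier G; b \<in> carrier G; c \<in> carrier G; a \<otimes> b = b \<otimes> c\<rbrakk> \<Longrightarrow> conj_elt a b = c"
  using conj_elt[of a b] by (auto intro: cancel[of b])

lemma lam_conj_elt:
  assumes "a \<in> carrier G" "b \<in> carrier G" "c \<in> carrier G"
  shows "lam a (conj_elt b c) = conj_elt (lam a b) (lam a c)"
  using assms conj_elt[of b c] hom_mult[OF lam_hom[OF assms(1)], symmetric]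
  by (intro conj_elt_eqI[symmetric]) auto

definition braid :: "'a \<times> 'a \<Rightarrow> 'a \<times> 'a" where
  "braid = (\<lambda>(a, b). (lam a b, inv_into (carrier G) (lam (lam a b)) (conj_elt a (lam a b))))"

abbreviation gamma :: "'a \<Rightarrow> 'a \<Rightarrow> 'a" where
  "gamma b a \<equiv> gam braid b a"

lemma sig_braid [simp]: "sig braid = lam"
  by (intro ext) (simp add: sig_def braid_def)

lemma braid_gamma: "braid (a, b) = (lam a b, gamma b a)"
  by (simp add: gam_def braid_def)

lemma gamma:
  assumes "a \<in> carrier G" "b \<in> carrier G"
  shows gamma_closed [simp]: "gamma b a \<in> carrier G"
    and lam_gamma: "lam (lam a b) (gamma b a) = conj_elt a (lam a b)"
  using lam_bij[of "lam a b"] conj_elt[of a "lam a b"] assms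
  by (auto simp: gam_def braid_def bij_betw_def inv_into_into f_inv_into_f)

text \<open>This identifies \<open>braid\<close> on elements where a candidate for the second component is known.\<close>

lemma gamma_eqI:
  assumes "a \<in> carrier G" "b \<in> carrier G" "c \<in> carrier G"
    and "a \<otimes> lam a b = lam a b \<otimes> lam (lam a b) c"
  shows "gamma b a = c"
proof (rule lam_inj)
  show "lam (lam a b) (gamma b a) = lam (lam a b) c"
    using assms conj_elt_eqI[of a "lam a b" "lam (lam a b) c"] by (simp add: lam_gamma)
qed (use assms in auto)

definition circ :: "'a \<Rightarrow> 'a \<Rightarrow> 'a" where
  "circ a b = a \<otimes> lam a b"

text \<open>Since \<open>lam (lam a b) (gamma b a)\<close> is the conjugate of \<open>a\<close> past \<open>lam a b\<close>, the map
  \<open>braid\<close> preserves the product of the two entries for \<open>circ\<close>.\<close>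

lemma circ_braid:
  assumes "a \<in> carrier G" "b \<in> carrier G"
  shows "circ (lam a b) (gamma b a) = circ a b"
  using assms conj_elt(2)[of a "lam a b"] by (simp add: circ_def lam_gamma)

lemma lam_braid:
  assumes "a \<in> carrier G" "b \<in> carrier G" "c \<in> carrier G"
  shows "lam (lam a b) (lam (gamma b a) c) = lam a (lam b c)"
  using assms circ_braid[of a b] lam_circ[of "lam a b" "gamma b a" c] lam_circ[of a b c]
  by (simp add: circ_def)

text \<open>The first components of the braid relation agree by the action law. The second ones agree
  after \<open>lam x (lam y z)\<close>, which turns both into conjugates of \<open>lam x y\<close>, as automorphisms
  commute with conjugation. Both triples have the \<open>circ\<close> product of \<open>x\<close>, \<open>y\<close>, \<open>z\<close>, so left
  cancellation makes the third components agree as well.\<close>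

lemma braid_relation:
  assumes x: "x \<in> carrier G" and y: "y \<in> carrier G" and z: "z \<in> carrier G"
  shows "(r_times_id braid \<circ> id_times_r braid \<circ> r_times_id braid) (x, y, z) =
    (id_times_r braid \<circ> r_times_id braid \<circ> id_times_r braid) (x, y, z)"
proof -
  let ?g = "lam (gamma (lam y z) x) (gamma z y)"
  let ?h = "gamma (lam (gamma y x) z) (lam x y)"
  let ?v = "gamma z (gamma y x)" and ?w = "gamma (gamma z y) (gamma (lam y z) x)"
  let ?u = "lam x (lam y z)"
  have first: "lam (lam x y) (lam (gamma y x) z) = ?u" by (rule lam_braid[OF x y z])
  have second: "?h = ?g"
  proof (rule lam_inj)
    have "lam ?u ?g = lam x (lam (lam y z) (gamma z y))"
      using x y z by (simp add: lam_braid)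
    also have "\<dots> = conj_elt (lam x y) ?u" using x y z by (simp add: lam_gamma lam_conj_elt)
    also have "\<dots> = lam ?u ?h"
      using lam_gamma[of "lam x y" "lam (gamma y x) z"] x y z by (simp add: first)
    finally show "lam ?u ?h = lam ?u ?g" by simp
  qed (use x y z in auto)
  have assoc: "circ (circ a b) c = circ a (circ b c)"
    if "a \<in> carrier G" "b \<in> carrier G" "c \<in> carrier G" for a b c
    using that by (simp add: circ_def lam_circ hom_mult[OF lam_hom] m_assoc)
  have cc: "circ a b \<in> carrier G" if "a \<in> carrier G" "b \<in> carrier G" for a b
    using that by (simp add: circ_def)
  have "circ (circ ?u ?h) ?v = circ (circ x y) z"
  proof -
    have "circ ?u ?h = circ (lam x y) (lam (gamma y x) z)"
      using circ_braid[of "lam x y" "lam (gamma y x) z"] x y z by (simp add: first)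
    then have "circ (circ ?u ?h) ?v = circ (lam x y) (circ (lam (gamma y x) z) ?v)"
      using x y z by (simp add: assoc)
    also have "\<dots> = circ (circ (lam x y) (gamma y x)) z"
      unfolding circ_braid[OF gamma_closed[OF x y] z] using x y z by (simp add: assoc)
    also have "\<dots> = circ (circ x y) z" using x y by (simp add: circ_braid)
    finally show ?thesis .
  qed
  also have "\<dots> = circ (circ ?u ?g) ?w"
  proof -
    have "circ (circ ?u ?g) ?w = circ ?u (circ (gamma (lam y z) x) (gamma z y))"
      using x y z by (simp add: assoc circ_braid)
    also have "\<dots> = circ (circ x (lam y z)) (gamma z y)"
      using x y z by (simp add: assoc[symmetric] circ_braid)
    also have "\<dots> = circ x (circ y z)" using x y z by (simp add: assoc circ_braid)
    finally show ?thesis using x y z by (simp add: assoc)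
  qed
  finally have *: "circ ?u ?h \<otimes> lam (circ ?u ?h) ?v = circ ?u ?h \<otimes> lam (circ ?u ?h) ?w"
    by (simp add: second circ_def)
  have ch: "circ ?u ?h \<in> carrier G" using x y z by (intro cc) simp_all
  have third: "?v = ?w"
    by (rule lam_inj[OF ch _ _ cancel[OF ch _ _ *]]) (use x y z ch in auto)
  have "(r_times_id braid \<circ> id_times_r braid \<circ> r_times_id braid) (x, y, z) =
      (lam (lam x y) (lam (gamma y x) z), ?h, ?v)"
    by (simp add: r_times_id_def id_times_r_def braid_gamma)
  moreover have "(id_times_r braid \<circ> r_times_id braid \<circ> id_times_r braid) (x, y, z) = (?u, ?g, ?w)"
    by (simp add: r_times_id_def id_times_r_def braid_gamma)
  ultimately show ?thesis by (simp only: first second third)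
qed

lemma braid_solution: "ybe_solution (carrier G) braid"
proof -
  have "carrier G \<noteq> {}" using one_closed by blast
  moreover have "braid \<in> carrier G \<times> carrier G \<rightarrow> carrier G \<times> carrier G"
    by (auto simp: braid_gamma)
  ultimately show ?thesis
    using braid_relation unfolding ybe_solution_def by (simp only: split_paired_Ball_Sigma) blast
qed

lemma braid_nondegenerate: "left_nondegenerate (carrier G) braid"
  using lam_bij by (simp add: left_nondegenerate_def)

end

lemma ybe_solution_restrict:
  assumes "ybe_solution A r" and "Y \<subseteq> A" and "Y \<noteq> {}" and closed: "r \<in> Y \<times> Y \<rightarrow> Y \<times> Y"
  shows "ybe_solution Y (restrict r (Y \<times> Y))"
proof -
  have c: "fst (r (a, b)) \<in> Y" "snd (r (a, b)) \<in> Y" if "a \<in> Y" "b \<in> Y" for a b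
    using closed that by (auto simp: Pi_def mem_Times_iff)
  let ?r = "restrict r (Y \<times> Y)"
  have agree: "r_times_id ?r t = r_times_id r t" "r_times_id r t \<in> Y \<times> Y \<times> Y"
      "id_times_r ?r t = id_times_r r t" "id_times_r r t \<in> Y \<times> Y \<times> Y"
    if "t \<in> Y \<times> Y \<times> Y" for t
  proof -
    from that obtain x y z where t: "t = (x, y, z)" "x \<in> Y" "y \<in> Y" "z \<in> Y" by auto
    show "r_times_id ?r t = r_times_id r t" "r_times_id r t \<in> Y \<times> Y \<times> Y"
      "id_times_r ?r t = id_times_r r t" "id_times_r r t \<in> Y \<times> Y \<times> Y"
      using c by (simp_all add: t r_times_id_def id_times_r_def mem_Times_iff)
  qed
  show ?thesis
    unfolding ybe_solution_def
  proof (intro conjI ballI)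
    show "?r \<in> Y \<times> Y \<rightarrow> Y \<times> Y" using closed by auto
    fix t assume t: "t \<in> Y \<times> Y \<times> Y"
    then have "t \<in> A \<times> A \<times> A" using assms(2) by auto
    then have "(r_times_id r \<circ> id_times_r r \<circ> r_times_id r) t =
        (id_times_r r \<circ> r_times_id r \<circ> id_times_r r) t"
      by (rule bspec[OF assms(1)[unfolded ybe_solution_def, THEN conjunct2, THEN conjunct2]])
    with t show "(r_times_id ?r \<circ> id_times_r ?r \<circ> r_times_id ?r) t =
        (id_times_r ?r \<circ> r_times_id ?r \<circ> id_times_r ?r) t"
      by (simp add: agree)
  qed (rule assms(3))
qed

section \<open>Automorphisms of monoids\<close>

text \<open>In a monoid this uses surjectivity: if \<open>f e\<close> is the unit, then \<open>f e = f (e \<otimes> \<one>) = f \<one>\<close>.\<close>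

lemma auto_one:
  assumes G: "monoid G" and f: "f \<in> auto G"
  shows "f \<one>\<^bsub>G\<^esub> = \<one>\<^bsub>G\<^esub>"
proof -
  interpret monoid G by (rule G)
  have hom: "f \<in> hom G G" and surj: "f ` carrier G = carrier G"
    using f by (auto simp: auto_def Bij_def bij_betw_def)
  then obtain e where e: "e \<in> carrier G" "f e = \<one>\<^bsub>G\<^esub>" by (metis imageE one_closed)
  have "f e = f e \<otimes>\<^bsub>G\<^esub> f \<one>\<^bsub>G\<^esub>"
    using hom_mult[OF hom e(1) one_closed] e(1) by simp
  then show ?thesis using e(2) hom_in_carrier[OF hom one_closed] by simp
qed

lemma auto_inv_hom:
  assumes G: "monoid G" and f: "f \<in> auto G"
  shows "restrict (inv_into (carrier G) f) (carrier G) \<in> hom G G"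
proof -
  interpret monoid G by (rule G)
  have f': "f \<in> hom G G" "f \<in> Bij (carrier G)" using f by (auto simp: auto_def)
  have "inv_into (carrier G) f (x \<otimes>\<^bsub>G\<^esub> y) = inv_into (carrier G) f x \<otimes>\<^bsub>G\<^esub> inv_into (carrier G) f y"
    if "x \<in> carrier G" "y \<in> carrier G" for x y
    by (rule Bij_inv_into_lemma) (use f' that in \<open>auto simp: hom_mult\<close>)
  with f' show ?thesis by (intro homI) (auto simp: Bij_inv_into_mem)
qed

lemma auto_bij: "f \<in> auto G \<Longrightarrow> bij_betw f (carrier G) (carrier G)"
  by (simp add: auto_def Bij_def)

lemma auto_hom: "f \<in> auto G \<Longrightarrow> f \<in> hom G G"
  by (simp add: auto_def)

lemma auto_extensional: "f \<in> auto G \<Longrightarrow> f \<in> extensional (carrier G)"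
  by (simp add: auto_def Bij_def)

lemma auto_closed: "f \<in> auto G \<Longrightarrow> x \<in> carrier G \<Longrightarrow> f x \<in> carrier G"
  by (rule hom_in_carrier[OF auto_hom])

lemma carrier_AutoGroup: "carrier (AutoGroup G) = auto G"
  by (simp add: AutoGroup_def)

lemma mult_AutoGroup:
  "f \<in> auto G \<Longrightarrow> g \<in> auto G \<Longrightarrow> f \<otimes>\<^bsub>AutoGroup G\<^esub> g = compose (carrier G) f g"
  by (simp add: AutoGroup_def BijGroup_def auto_def)

lemma hom_AutoGroup_one:
  assumes H: "monoid H" and l: "l \<in> hom H (AutoGroup G)" and x: "x \<in> carrier G"
  shows "l \<one>\<^bsub>H\<^esub> x = x"
proof -
  interpret monoid H by (rule H)
  have a: "l \<one>\<^bsub>H\<^esub> \<in> auto G"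
    using hom_in_carrier[OF l one_closed] by (simp add: carrier_AutoGroup)
  have "compose (carrier G) (l \<one>\<^bsub>H\<^esub>) (l \<one>\<^bsub>H\<^esub>) = l \<one>\<^bsub>H\<^esub>"
    using hom_mult[OF l one_closed one_closed] mult_AutoGroup[OF a a] by simp
  then have "l \<one>\<^bsub>H\<^esub> (l \<one>\<^bsub>H\<^esub> x) = l \<one>\<^bsub>H\<^esub> x"
    using x by (metis compose_eq)
  then show ?thesis
    by (rule inj_onD[OF bij_betw_imp_inj_on[OF auto_bij[OF a]]]) (intro auto_closed[OF a] x)+
qed

section \<open>The structure monoid in terms of words\<close>

context lnd_solution
begin

definition induced :: "('a \<Rightarrow> 'a) \<Rightarrow> 'a list set \<Rightarrow> 'a list set" where
  "induced f = (\<lambda>B \<in> carrier D.pm. \<Union>p \<in> B. D.cls (map f p))"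

lemma induced_extensional: "induced f \<in> extensional (carrier D.pm)"
  by (simp add: induced_def)

lemma induced_cls:
  assumes f: "equivariant f" and p: "p \<in> lists X"
  shows "induced f (D.cls p) = D.cls (map f p)"
proof -
  have "D.cls (map f q) = D.cls (map f p)" if "q \<in> D.cls p" for q
  proof -
    have "(map f p, map f q) \<in> D.cong" using that by (intro map_cong_D[OF f]) simp
    moreover from this have "map f p \<in> lists X" "map f q \<in> lists X" using D.cong_facts(1) by blast+
    ultimately show ?thesis using D.cls_eq_iff by blast
  qed
  moreover have "p \<in> D.cls p" using D.cong_facts(2)[OF p] by simp
  ultimately have "(\<Union>q \<in> D.cls p. D.cls (map f q)) = D.cls (map f p)" by blast
  then show ?thesis using p by (simp add: induced_def)
qed

text \<open>The inverse letter map is equivariant too and induces the inverse.\<close>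

lemma induced_auto:
  assumes f: "equivariant f" "bij_betw f X X"
  shows "induced f \<in> auto D.pm"
proof -
  let ?g = "inv_into X f"
  have g: "equivariant ?g" by (rule equivariant_inv[OF f])
  have fL: "map f p \<in> lists X" and gL: "map ?g p \<in> lists X" if "p \<in> lists X" for p
    by (rule map_in_lists[OF _ that]; use f(1) g in \<open>auto simp: equivariant_def\<close>)+
  have gf: "map ?g (map f p) = p" and fg: "map f (map ?g p) = p" if "p \<in> lists X" for p
    using that bij_betw_inv_into_left[OF f(2)] bij_betw_inv_into_right[OF f(2)]
    by (auto simp: in_lists_conv_set intro!: map_idI)
  have "induced f \<in> hom D.pm D.pm"
    by (rule homI) (auto simp: D.carrier_pm induced_cls[OF f(1)] D.mult_pm fL simp del: map_map)
  moreover have "bij_betw (induced f) (carrier D.pm) (carrier D.pm)"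
    by (rule bij_betwI[of _ _ _ "induced ?g"])
      (auto simp: D.carrier_pm induced_cls[OF f(1)] induced_cls[OF g] fL gL gf fg simp del: map_map)
  ultimately show ?thesis by (auto simp: auto_def Bij_def induced_def)
qed

lemma induced_act_auto: "u \<in> lists X \<Longrightarrow> induced (act u) \<in> auto D.pm"
  by (intro induced_auto act_equivariant act_bij)

lemma induced_act_cls:
  "u \<in> lists X \<Longrightarrow> p \<in> lists X \<Longrightarrow> induced (act u) (D.cls p) = D.cls (map (act u) p)"
  by (intro induced_cls act_equivariant)

lemma act_append: "act (u @ v) = act u \<circ> act v"
  by (simp add: fun_eq_iff)

lemma induced_act_append:
  assumes "u \<in> lists X" "v \<in> lists X"
  shows "compose (carrier D.pm) (induced (act u)) (induced (act v)) = induced (act (u @ v))"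
proof (rule extensionalityI)
  show "induced (act (u @ v)) \<in> extensional (carrier D.pm)" by (simp add: induced_def)
  fix B assume "B \<in> carrier D.pm"
  then obtain p where "p \<in> lists X" "B = D.cls p" by (auto simp: D.carrier_pm)
  with assms show "compose (carrier D.pm) (induced (act u)) (induced (act v)) B = induced (act (u @ v)) B"
    using induced_act_cls[of "u @ v" p] by (simp add: compose_eq induced_act_cls act_append)
qed simp

lemma derived_auto_determined:
  assumes f: "f \<in> auto D.pm" and gen: "\<And>y. y \<in> X \<Longrightarrow> f (D.cls [y]) = D.cls [h y]"
    and h: "\<And>y. y \<in> X \<Longrightarrow> h y \<in> X" and p: "p \<in> lists X"
  shows "f (D.cls p) = D.cls (map h p)"
  using p
proof (induction p)
  case Nil
  then show ?case using auto_one[OF D.monoid_pm f] by (simp add: D.one_pm)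
next
  case (Cons y p)
  then have y: "y \<in> X" and p: "p \<in> lists X" and IH: "f (D.cls p) = D.cls (map h p)" by simp_all
  have hp: "map h p \<in> lists X" by (rule map_in_lists[OF h p])
  have "f (D.cls (y # p)) = f (D.cls [y]) \<otimes>\<^bsub>D.pm\<^esub> f (D.cls p)"
    unfolding D.cls_Cons[OF y p] by (rule hom_mult[OF auto_hom[OF f]]) (simp_all add: y p)
  also have "\<dots> = D.cls (h y # map h p)"
    unfolding gen[OF y] IH by (rule D.cls_Cons[symmetric, OF h[OF y] hp])
  finally show ?case by simp
qed

definition lambda_words :: "'a list set \<Rightarrow> 'a list set \<Rightarrow> 'a list set" where
  "lambda_words =
     (\<lambda>A \<in> carrier S.pm. \<lambda>B \<in> carrier D.pm. \<Union>u \<in> A. induced (act u) B)"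

lemma lambda_words_cls:
  assumes u: "u \<in> lists X"
  shows "lambda_words (S.cls u) = induced (act u)"
proof (rule extensionalityI)
  show "lambda_words (S.cls u) \<in> extensional (carrier D.pm)"
    using u by (simp add: lambda_words_def)
  fix B assume B: "B \<in> carrier D.pm"
  then obtain p where p: "p \<in> lists X" "B = D.cls p" by (auto simp: D.carrier_pm)
  have "induced (act v) B = induced (act u) B" if "v \<in> S.cls u" for v
  proof -
    have uv: "(u, v) \<in> S.cong" using that by simp
    then have v: "v \<in> lists X" using S.cong_facts(1) by blast
    show ?thesis
      unfolding p(2) induced_act_cls[OF u p(1)] induced_act_cls[OF v p(1)]
      by (simp only: S_cong_map_act[OF uv p(1)])
  qed
  moreover have "u \<in> S.cls u" using S.cong_facts(2)[OF u] by simp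
  ultimately have "(\<Union>v \<in> S.cls u. induced (act v) B) = induced (act u) B" by blast
  then show "lambda_words (S.cls u) B = induced (act u) B" using u B by (simp add: lambda_words_def)
qed (rule induced_extensional)

text \<open>For uniqueness, the letters generate both monoids: an automorphism of the derived monoid is
  determined on its generators, as it fixes the unit, and a homomorphism into the automorphisms,
  which sends the unit to the identity, is then determined by its values on the letters.\<close>

lemma lambda'_words: "lambda' X r = lambda_words"
  unfolding lambda'_def structure_monoid_def derived_monoid_def structure_gen_def derived_gen_def
    S.presented_gen_cls D.presented_gen_cls
proof (rule the_equality)
  have "lambda_words \<in> hom S.pm (AutoGroup D.pm)"
  proof (rule homI)
    fix A B assume "A \<in> carrier S.pm" "B \<in> carrier S.pm"
    then obtain u v where uv: "u \<in> lists X" "A = S.cls u" "v \<in> lists X" "B = S.cls v"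
      by (auto simp: S.carrier_pm)
    then show "lambda_words A \<in> carrier (AutoGroup D.pm)"
      by (simp add: lambda_words_cls induced_act_auto carrier_AutoGroup)
    have "lambda_words (A \<otimes>\<^bsub>S.pm\<^esub> B) = induced (act (u @ v))"
      unfolding uv S.mult_pm[OF uv(1,3)] by (rule lambda_words_cls) (simp add: uv)
    also have "\<dots> = lambda_words A \<otimes>\<^bsub>AutoGroup D.pm\<^esub> lambda_words B"
      unfolding uv lambda_words_cls[OF uv(1)] lambda_words_cls[OF uv(3)]
        mult_AutoGroup[OF induced_act_auto[OF uv(1)] induced_act_auto[OF uv(3)]]
      by (rule induced_act_append[symmetric, OF uv(1,3)])
    finally show "lambda_words (A \<otimes>\<^bsub>S.pm\<^esub> B) = lambda_words A \<otimes>\<^bsub>AutoGroup D.pm\<^esub> lambda_words B" .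
  qed
  moreover have "lambda_words (S.cls [x]) (D.cls [y]) = D.cls [sig r x y]" if "x \<in> X" "y \<in> X" for x y
    using that lambda_words_cls[of "[x]"] induced_act_cls[of "[x]" "[y]"] by simp
  ultimately show "lambda_words \<in> hom S.pm (AutoGroup D.pm) \<and>
    lambda_words \<in> extensional (carrier S.pm) \<and>
    (\<forall>x \<in> X. \<forall>y \<in> X. lambda_words (S.cls [x]) (D.cls [y]) = D.cls [sig r x y])"
    by (auto simp: lambda_words_def)
next
  fix l assume "l \<in> hom S.pm (AutoGroup D.pm) \<and> l \<in> extensional (carrier S.pm) \<and>
    (\<forall>x \<in> X. \<forall>y \<in> X. l (S.cls [x]) (D.cls [y]) = D.cls [sig r x y])"
  then have hom: "l \<in> hom S.pm (AutoGroup D.pm)" and ext: "l \<in> extensional (carrier S.pm)"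
    and gen: "\<And>x y. x \<in> X \<Longrightarrow> y \<in> X \<Longrightarrow> l (S.cls [x]) (D.cls [y]) = D.cls [sig r x y]"
    by blast+
  have auto: "l (S.cls u) \<in> auto D.pm" if "u \<in> lists X" for u
    using hom_in_carrier[OF hom S.cls_closed[OF that]] by (simp add: carrier_AutoGroup)
  have letter: "l (S.cls [x]) = induced (act [x])" if x: "x \<in> X" for x
  proof (rule extensionalityI)
    show "l (S.cls [x]) \<in> extensional (carrier D.pm)"
      by (rule auto_extensional[OF auto]) (simp add: x)
    fix B assume "B \<in> carrier D.pm"
    then obtain p where p: "p \<in> lists X" "B = D.cls p" by (auto simp: D.carrier_pm)
    have "l (S.cls [x]) (D.cls p) = D.cls (map (sig r x) p)"
      by (rule derived_auto_determined) (simp_all add: x p(1) auto gen)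
    then show "l (S.cls [x]) B = induced (act [x]) B"
      using induced_act_cls[of "[x]" p] x p by simp
  qed (rule induced_extensional)
  have word: "l (S.cls u) = induced (act u)" if "u \<in> lists X" for u
    using that
  proof (induction u)
    case Nil
    show ?case
    proof (rule extensionalityI)
      show "l (S.cls []) \<in> extensional (carrier D.pm)"
        by (rule auto_extensional[OF auto]) simp
      fix B assume B: "B \<in> carrier D.pm"
      then obtain p where p: "p \<in> lists X" "B = D.cls p" by (auto simp: D.carrier_pm)
      have "l (S.cls []) B = B"
        using hom_AutoGroup_one[OF S.monoid_pm hom B] by (simp add: S.one_pm)
      then show "l (S.cls []) B = induced (act []) B"
        using induced_act_cls[of "[]" p] p by simp
    qed (rule induced_extensional)
  next
    case (Cons x u)
    then have x: "x \<in> X" and u: "u \<in> lists X" and IH: "l (S.cls u) = induced (act u)" by simp_all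
    have x': "[x] \<in> lists X" using x by simp
    have "l (S.cls (x # u)) = l (S.cls [x]) \<otimes>\<^bsub>AutoGroup D.pm\<^esub> l (S.cls u)"
      unfolding S.cls_Cons[OF x u] by (rule hom_mult[OF hom]) (simp_all add: x u)
    also have "\<dots> = compose (carrier D.pm) (induced (act [x])) (induced (act u))"
      unfolding letter[OF x] IH
      by (rule mult_AutoGroup[OF induced_act_auto[OF x'] induced_act_auto[OF u]])
    also have "\<dots> = induced (act (x # u))"
      using induced_act_append[OF x' u] by simp
    finally show ?case .
  qed
  show "l = lambda_words"
  proof (rule extensionalityI[OF ext])
    show "lambda_words \<in> extensional (carrier S.pm)" by (simp add: lambda_words_def)
    fix A assume "A \<in> carrier S.pm"
    then show "l A = lambda_words A" by (auto simp: S.carrier_pm word lambda_words_cls)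
  qed
qed

lemma lambda'_cls: "u \<in> lists X \<Longrightarrow> lambda' X r (S.cls u) = induced (act u)"
  by (simp add: lambda'_words lambda_words_cls)

definition pi_words :: "'a list set \<Rightarrow> 'a list set" where
  "pi_words = (\<lambda>A \<in> carrier S.pm. \<Union>u \<in> A. D.cls (twist u))"

lemma pi_words_cls:
  assumes u: "u \<in> lists X"
  shows "pi_words (S.cls u) = D.cls (twist u)"
proof -
  have "D.cls (twist v) = D.cls (twist u)" if "v \<in> S.cls u" for v
  proof -
    have uv: "(u, v) \<in> S.cong" using that by simp
    then have v: "v \<in> lists X" using S.cong_facts(1) by blast
    then show ?thesis using uv u D.cls_eq_iff[of "twist u" "twist v"] twist_cong_iff[OF u v] by simp
  qed
  moreover have "u \<in> S.cls u" using S.cong_facts(2)[OF u] by simp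
  ultimately have "(\<Union>v \<in> S.cls u. D.cls (twist v)) = D.cls (twist u)" by blast
  then show ?thesis using u by (simp add: pi_words_def)
qed

lemma pi_map_words: "pi_map X r = pi_words"
  unfolding pi_map_def structure_monoid_def derived_monoid_def structure_gen_def derived_gen_def
    S.presented_gen_cls D.presented_gen_cls
proof (rule the_equality)
  have "pi_words \<in> carrier S.pm \<rightarrow>\<^sub>E carrier D.pm"
  proof
    fix A assume "A \<in> carrier S.pm"
    then obtain u where "u \<in> lists X" "A = S.cls u" by (auto simp: S.carrier_pm)
    then show "pi_words A \<in> carrier D.pm" by (simp add: pi_words_cls)
  qed (simp add: pi_words_def)
  moreover have "pi_words (S.cls [x]) = D.cls [x]" if "x \<in> X" for x
    using that pi_words_cls[of "[x]"] by simp
  moreover have "pi_words (A \<otimes>\<^bsub>S.pm\<^esub> B) = pi_words A \<otimes>\<^bsub>D.pm\<^esub> lambda' X r A (pi_words B)"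
    if AB: "A \<in> carrier S.pm" "B \<in> carrier S.pm" for A B
  proof -
    obtain u v where u: "u \<in> lists X" "A = S.cls u" and v: "v \<in> lists X" "B = S.cls v"
      using AB by (auto simp: S.carrier_pm)
    have "pi_words (A \<otimes>\<^bsub>S.pm\<^esub> B) = D.cls (twist u @ map (act u) (twist v))"
      unfolding u v S.mult_pm[OF u(1) v(1)] twist_append[symmetric]
      by (rule pi_words_cls) (simp add: u v)
    also have "\<dots> = D.cls (twist u) \<otimes>\<^bsub>D.pm\<^esub> D.cls (map (act u) (twist v))"
      using u v by (intro D.mult_pm[symmetric]) simp_all
    also have "\<dots> = pi_words A \<otimes>\<^bsub>D.pm\<^esub> lambda' X r A (pi_words B)"
      using u v by (simp add: pi_words_cls lambda'_cls induced_act_cls)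
    finally show ?thesis .
  qed
  ultimately show "pi_words \<in> carrier S.pm \<rightarrow>\<^sub>E carrier D.pm \<and>
    (\<forall>x \<in> X. pi_words (S.cls [x]) = D.cls [x]) \<and>
    (\<forall>a \<in> carrier S.pm. \<forall>b \<in> carrier S.pm.
       pi_words (a \<otimes>\<^bsub>S.pm\<^esub> b) = pi_words a \<otimes>\<^bsub>D.pm\<^esub> lambda' X r a (pi_words b))"
    by blast
next
  fix p assume "p \<in> carrier S.pm \<rightarrow>\<^sub>E carrier D.pm \<and>
    (\<forall>x \<in> X. p (S.cls [x]) = D.cls [x]) \<and>
    (\<forall>a \<in> carrier S.pm. \<forall>b \<in> carrier S.pm.
       p (a \<otimes>\<^bsub>S.pm\<^esub> b) = p a \<otimes>\<^bsub>D.pm\<^esub> lambda' X r a (p b))"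
  then have p: "p \<in> carrier S.pm \<rightarrow>\<^sub>E carrier D.pm" and gen: "\<And>x. x \<in> X \<Longrightarrow> p (S.cls [x]) = D.cls [x]"
    and mult: "\<And>a b. a \<in> carrier S.pm \<Longrightarrow> b \<in> carrier S.pm \<Longrightarrow>
      p (a \<otimes>\<^bsub>S.pm\<^esub> b) = p a \<otimes>\<^bsub>D.pm\<^esub> lambda' X r a (p b)"
    by blast+
  have word: "p (S.cls u) = D.cls (twist u)" if "u \<in> lists X" for u
    using that
  proof (induction u)
    case Nil
    have "p (S.cls []) \<in> carrier D.pm" by (rule PiE_mem[OF p]) simp
    then obtain q where q: "q \<in> lists X" "p (S.cls []) = D.cls q" by (auto simp: D.carrier_pm)
    \<comment> \<open>The image of the unit is idempotent, and word length is additive on the derived monoid.\<close>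
    have "D.cls q = D.cls q \<otimes>\<^bsub>D.pm\<^esub> lambda' X r (S.cls []) (D.cls q)"
      using mult[OF S.cls_closed[OF lists.Nil] S.cls_closed[OF lists.Nil]]
      unfolding S.mult_pm[OF lists.Nil lists.Nil] append_Nil q(2) .
    also have "\<dots> = D.cls (q @ q)"
      unfolding lambda'_cls[OF lists.Nil] induced_act_cls[OF lists.Nil q(1)]
      unfolding foldr.simps list.map_id by (rule D.mult_pm[OF q(1) q(1)])
    finally have "(q, q @ q) \<in> D.cong" using q(1) D.cls_eq_iff[of q "q @ q"] by simp
    from D_cong_length[OF this] have "q = []" by simp
    then show ?case using q(2) by simp
  next
    case (Cons x u)
    then have x: "x \<in> X" and u: "u \<in> lists X" and IH: "p (S.cls u) = D.cls (twist u)" by simp_all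
    have "p (S.cls (x # u)) = D.cls [x] \<otimes>\<^bsub>D.pm\<^esub> D.cls (map (sig r x) (twist u))"
      unfolding S.cls_Cons[OF x u]
      using mult[of "S.cls [x]" "S.cls u"] lambda'_cls[of "[x]"] induced_act_cls[of "[x]" "twist u"] x u
      by (simp add: gen IH)
    also have "\<dots> = D.cls (twist (x # u))"
      using D.cls_Cons[of x "map (sig r x) (twist u)"] map_act_closed[of "[x]" "twist u"] x u by simp
    finally show ?case .
  qed
  show "p = pi_words"
  proof (rule extensionalityI[of _ "carrier S.pm"])
    show "p \<in> extensional (carrier S.pm)" using p by (simp add: PiE_def)
    show "pi_words \<in> extensional (carrier S.pm)" by (simp add: pi_words_def)
    fix A assume "A \<in> carrier S.pm"
    then show "p A = pi_words A" by (auto simp: S.carrier_pm word pi_words_cls)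
  qed
qed

lemma pi_inv_cls:
  assumes u: "u \<in> lists X"
  shows "pi_inv X r (D.cls (twist u)) = S.cls u"
  unfolding pi_inv_def pi_map_words structure_monoid_def
proof (rule inv_into_f_eq)
  show "inj_on pi_words (carrier S.pm)"
  proof (rule inj_onI)
    fix A B assume A: "A \<in> carrier S.pm" and B: "B \<in> carrier S.pm"
      and eq: "pi_words A = pi_words B"
    from A obtain u where u: "u \<in> lists X" "A = S.cls u" unfolding S.carrier_pm by blast
    from B obtain v where v: "v \<in> lists X" "B = S.cls v" unfolding S.carrier_pm by blast
    note uv = u v
    have "D.cls (twist u) = D.cls (twist v)"
      using eq unfolding uv pi_words_cls[OF uv(1)] pi_words_cls[OF uv(3)] .
    then have "(twist u, twist v) \<in> D.cong"
      by (rule D.cls_eq_iff[THEN iffD1, rotated 2]) (simp_all add: uv)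
    then have "(u, v) \<in> S.cong" by (rule twist_cong_iff[OF uv(1,3), THEN iffD1])
    then show "A = B" unfolding uv by (rule S.cls_eq_iff[OF uv(1,3), THEN iffD2])
  qed
  show "S.cls u \<in> carrier S.pm" by (rule S.cls_closed[OF u])
  show "pi_words (S.cls u) = D.cls (twist u)" by (rule pi_words_cls[OF u])
qed

end

section \<open>The two operations on the derived monoid\<close>

context lnd_solution
begin

lemma M_add_pm: "M_add X r = D.pm"
  by (simp add: M_add_def derived_monoid_def)

lemma M_word:
  assumes "a \<in> carrier (M_add X r)"
  obtains u where "u \<in> lists X" "a = D.cls (twist u)"
proof -
  obtain p where p: "p \<in> lists X" "a = D.cls p"
    using assms unfolding M_add_pm D.carrier_pm by blast
  obtain u where "u \<in> lists X" "p = twist u" using p(1) by (rule twist_surj)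
  with p(2) that show thesis by blast
qed

lemma lambda_M_cls: "u \<in> lists X \<Longrightarrow> lambda_M X r (D.cls (twist u)) = induced (act u)"
  by (simp add: lambda_M_def pi_inv_cls lambda'_cls)

lemma lambda_M_auto:
  assumes "a \<in> carrier (M_add X r)"
  shows "lambda_M X r a \<in> auto (M_add X r)"
  using assms by (rule M_word) (simp add: lambda_M_cls M_add_pm induced_act_auto)

lemma lambda_M_closed:
  "a \<in> carrier (M_add X r) \<Longrightarrow> b \<in> carrier (M_add X r) \<Longrightarrow> lambda_M X r a b \<in> carrier (M_add X r)"
  by (rule auto_closed[OF lambda_M_auto])

lemma M_add_monoid: "monoid (M_add X r)"
  unfolding M_add_pm by (rule D.monoid_pm)

lemma M_circ_simps [simp]:
  "carrier (M_circ X r) = carrier (M_add X r)" "\<one>\<^bsub>M_circ X r\<^esub> = \<one>\<^bsub>M_add X r\<^esub>"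
  using pi_words_cls[of "[]"]
  by (simp_all add: M_circ_def M_add_pm structure_monoid_def S.one_pm D.one_pm pi_map_words)

lemma M_circ_word:
  assumes u: "u \<in> lists X" and v: "v \<in> lists X"
  shows "D.cls (twist u) \<otimes>\<^bsub>M_circ X r\<^esub> D.cls (twist v) = D.cls (twist (u @ v))"
proof -
  have "u @ v \<in> lists X" using u v by simp
  then show ?thesis
    unfolding M_circ_def structure_monoid_def
    by (simp add: pi_inv_cls u v S.mult_pm pi_map_words pi_words_cls)
qed

lemma M_circ_add:
  assumes "a \<in> carrier (M_add X r)" "b \<in> carrier (M_add X r)"
  shows "a \<otimes>\<^bsub>M_circ X r\<^esub> b = a \<otimes>\<^bsub>M_add X r\<^esub> lambda_M X r a b"
proof -
  obtain u v where u: "u \<in> lists X" "a = D.cls (twist u)" and v: "v \<in> lists X" "b = D.cls (twist v)"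
    using assms by (meson M_word)
  have "a \<otimes>\<^bsub>M_add X r\<^esub> lambda_M X r a b = D.cls (twist u) \<otimes>\<^bsub>D.pm\<^esub> D.cls (map (act u) (twist v))"
    unfolding u v lambda_M_cls[OF u(1)] M_add_pm induced_act_cls[OF u(1) twist_closed[OF v(1)]] ..
  also have "\<dots> = D.cls (twist (u @ v))"
    unfolding twist_append by (rule D.mult_pm) (simp_all add: u(1) v(1))
  finally show ?thesis unfolding u(2) v(2) M_circ_word[OF u(1) v(1)] by simp
qed

lemma lambda_M_circ:
  assumes "a \<in> carrier (M_add X r)" "b \<in> carrier (M_add X r)" and c: "c \<in> carrier (M_add X r)"
  shows "lambda_M X r (a \<otimes>\<^bsub>M_circ X r\<^esub> b) c = lambda_M X r a (lambda_M X r b c)"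
proof -
  obtain u v where u: "u \<in> lists X" "a = D.cls (twist u)" and v: "v \<in> lists X" "b = D.cls (twist v)"
    using assms by (meson M_word)
  have uv: "u @ v \<in> lists X" using u v by simp
  have "lambda_M X r (a \<otimes>\<^bsub>M_circ X r\<^esub> b) c = compose (carrier D.pm) (induced (act u)) (induced (act v)) c"
    unfolding u(2) v(2) M_circ_word[OF u(1) v(1)] lambda_M_cls[OF uv] induced_act_append[OF u(1) v(1)] ..
  then show ?thesis
    using c by (simp add: compose_eq M_add_pm u v lambda_M_cls)
qed

lemma lambda_M_one:
  assumes "a \<in> carrier (M_add X r)"
  shows "lambda_M X r \<one>\<^bsub>M_add X r\<^esub> a = a"
proof -
  obtain p where p: "p \<in> lists X" "a = D.cls p"
    using assms unfolding M_add_pm D.carrier_pm by blast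
  show ?thesis
    using lambda_M_cls[of "[]"] induced_act_cls[of "[]" p] p by (simp add: M_add_pm D.one_pm)
qed

lemma M_circ_monoid: "monoid (M_circ X r)"
proof -
  interpret M: monoid "M_add X r" by (rule M_add_monoid)
  show ?thesis
  proof (rule monoidI)
    fix a b c
    assume abc: "a \<in> carrier (M_circ X r)" "b \<in> carrier (M_circ X r)" "c \<in> carrier (M_circ X r)"
    obtain u where u: "u \<in> lists X" "a = D.cls (twist u)" using abc(1) M_word by (metis M_circ_simps(1))
    obtain v where v: "v \<in> lists X" "b = D.cls (twist v)" using abc(2) M_word by (metis M_circ_simps(1))
    obtain w where w: "w \<in> lists X" "c = D.cls (twist w)" using abc(3) M_word by (metis M_circ_simps(1))
    have uv: "u @ v \<in> lists X" and vw: "v @ w \<in> lists X" using u(1) v(1) w(1) by simp_all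
    show "a \<otimes>\<^bsub>M_circ X r\<^esub> b \<otimes>\<^bsub>M_circ X r\<^esub> c = a \<otimes>\<^bsub>M_circ X r\<^esub> (b \<otimes>\<^bsub>M_circ X r\<^esub> c)"
      unfolding u(2) v(2) w(2) M_circ_word[OF u(1) v(1)] M_circ_word[OF v(1) w(1)]
        M_circ_word[OF uv w(1)] M_circ_word[OF u(1) vw] append_assoc ..
  next
    fix a assume "a \<in> carrier (M_circ X r)"
    then have a: "a \<in> carrier (M_add X r)" by simp
    show "\<one>\<^bsub>M_circ X r\<^esub> \<otimes>\<^bsub>M_circ X r\<^esub> a = a"
      using a by (simp add: M_circ_add lambda_M_one)
    show "a \<otimes>\<^bsub>M_circ X r\<^esub> \<one>\<^bsub>M_circ X r\<^esub> = a"
      using a auto_one[OF M_add_monoid lambda_M_auto[OF a]] by (simp add: M_circ_add)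
  qed (simp_all add: M_circ_add lambda_M_closed)
qed

lemma M_normal:
  assumes "a \<in> carrier (M_add X r)" "b \<in> carrier (M_add X r)"
  shows "\<exists>c \<in> carrier (M_add X r). a \<otimes>\<^bsub>M_add X r\<^esub> b = b \<otimes>\<^bsub>M_add X r\<^esub> c"
proof -
  obtain p q where p: "p \<in> lists X" "a = D.cls p" and q: "q \<in> lists X" "b = D.cls q"
    using assms unfolding M_add_pm D.carrier_pm by blast
  obtain s where s: "s \<in> lists X" "(p @ q, q @ s) \<in> D.cong" using D_normal[OF p(1) q(1)] by blast
  have "D.cls (p @ q) = D.cls (q @ s)"
    by (rule D.cls_eq_iff[THEN iffD2]) (simp_all add: p(1) q(1) s)
  then have "D.cls p \<otimes>\<^bsub>D.pm\<^esub> D.cls q = D.cls q \<otimes>\<^bsub>D.pm\<^esub> D.cls s"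
    unfolding D.mult_pm[OF p(1) q(1)] D.mult_pm[OF q(1) s(1)] .
  with D.cls_closed[OF s(1)] show ?thesis unfolding M_add_pm p(2) q(2) by blast
qed

lemma derived_gen_cls: "derived_gen X r x = D.cls [x]"
  by (simp add: derived_gen_def D.presented_gen_cls)

lemma derived_gen_closed: "x \<in> X \<Longrightarrow> derived_gen X r x \<in> carrier (M_add X r)"
  by (simp add: derived_gen_cls M_add_pm)

lemma lambda_M_gen:
  assumes "x \<in> X" "y \<in> X"
  shows "lambda_M X r (derived_gen X r x) (derived_gen X r y) = derived_gen X r (sig r x y)"
  using assms lambda_M_cls[of "[x]"] induced_act_cls[of "[x]" "[y]"] by (simp add: derived_gen_cls)

lemma M_add_gen:
  assumes x: "x \<in> X" and y: "y \<in> X"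
  shows "derived_gen X r x \<otimes>\<^bsub>M_add X r\<^esub> derived_gen X r (sig r x y) =
    derived_gen X r (sig r x y) \<otimes>\<^bsub>M_add X r\<^esub> derived_gen X r (sig r (sig r x y) (gam r y x))"
proof -
  have "([x, sig r x y], [sig r x y, sig r (sig r x y) (gam r y x)]) \<in> D.cong"
    by (rule D.cong_relation) (use x y in \<open>auto simp: derived_relations_def\<close>)
  then have "D.cls [x, sig r x y] = D.cls [sig r x y, sig r (sig r x y) (gam r y x)]"
    by (rule D.cls_eq_iff[THEN iffD2, rotated 2]) (simp_all add: x y)
  then show ?thesis
    unfolding M_add_pm derived_gen_cls using D.mult_pm[of "[_]" "[_]"] x y by simp
qed

end

section \<open>The left cancellative quotient\<close>

locale lnd_quotient = lnd_solution +
  assumes eta_circ: "monoid_congruence (M_circ X r) (eta X r)"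
begin

abbreviation bar :: "'a list set \<Rightarrow> 'a list set set" where
  "bar a \<equiv> eta X r `` {a}"

lemma eta_add: "monoid_congruence (M_add X r) (eta X r)"
  unfolding eta_def by (rule left_cancellative_congruence_least(1)[OF M_add_monoid])

lemmas eta_facts = monoid_congruenceD[OF eta_add]

lemma eta_cancel:
  assumes "a \<in> carrier (M_add X r)" "b \<in> carrier (M_add X r)" "c \<in> carrier (M_add X r)"
    and "(a \<otimes>\<^bsub>M_add X r\<^esub> b, a \<otimes>\<^bsub>M_add X r\<^esub> c) \<in> eta X r"
  shows "(b, c) \<in> eta X r"
  using left_cancellative_congruence_least(2)[OF M_add_monoid] assms
  unfolding eta_def[symmetric] left_cancellative_quotient_iff[OF M_add_monoid eta_add] by blast

lemma eta_closed:
  assumes "(a, b) \<in> eta X r"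
  shows "a \<in> carrier (M_add X r)" "b \<in> carrier (M_add X r)"
  using assms eta_facts(1) by blast+

lemma eta_hom: "f \<in> hom (M_add X r) (M_add X r) \<Longrightarrow> (a, b) \<in> eta X r \<Longrightarrow> (f a, f b) \<in> eta X r"
  unfolding eta_def by (rule left_cancellative_congruence_endomorphism[OF M_add_monoid])

lemma carrier_Mbar_add: "carrier (Mbar_add X r) = bar ` carrier (M_add X r)"
  by (simp add: Mbar_add_def carrier_quotient_monoid)

lemma carrier_Mbar_circ: "carrier (Mbar_circ X r) = carrier (Mbar_add X r)"
  by (simp add: Mbar_circ_def carrier_Mbar_add carrier_quotient_monoid)

lemma bar_closed: "a \<in> carrier (M_add X r) \<Longrightarrow> bar a \<in> carrier (Mbar_add X r)"
  by (simp add: carrier_Mbar_add)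

lemma bar_cases:
  assumes "A \<in> carrier (Mbar_add X r)"
  obtains a where "a \<in> carrier (M_add X r)" "A = bar a"
  using assms unfolding carrier_Mbar_add by blast

lemma bar_eq_iff:
  "a \<in> carrier (M_add X r) \<Longrightarrow> b \<in> carrier (M_add X r) \<Longrightarrow> bar a = bar b \<longleftrightarrow> (a, b) \<in> eta X r"
  by (rule monoid_congruence_class_eq_iff[OF eta_add])

lemma bar_eqI: "(a, b) \<in> eta X r \<Longrightarrow> bar a = bar b"
  using bar_eq_iff eta_closed by blast

lemma bar_add:
  "a \<in> carrier (M_add X r) \<Longrightarrow> b \<in> carrier (M_add X r) \<Longrightarrow>
    bar a \<otimes>\<^bsub>Mbar_add X r\<^esub> bar b = bar (a \<otimes>\<^bsub>M_add X r\<^esub> b)"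
  unfolding Mbar_add_def by (rule quotient_monoid_mult_class[OF M_add_monoid eta_add])

lemma bar_circ:
  "a \<in> carrier (M_add X r) \<Longrightarrow> b \<in> carrier (M_add X r) \<Longrightarrow>
    bar a \<otimes>\<^bsub>Mbar_circ X r\<^esub> bar b = bar (a \<otimes>\<^bsub>M_circ X r\<^esub> b)"
  unfolding Mbar_circ_def by (rule quotient_monoid_mult_class[OF M_circ_monoid eta_circ]) simp_all

lemma Mbar_add_monoid: "monoid (Mbar_add X r)"
  unfolding Mbar_add_def by (rule monoid_quotient_monoid[OF M_add_monoid eta_add])

lemma Mbar_circ_monoid: "monoid (Mbar_circ X r)"
  unfolding Mbar_circ_def by (rule monoid_quotient_monoid[OF M_circ_monoid eta_circ])

text \<open>In the second argument this is the invariance of \<open>eta\<close> under automorphisms. In the first,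
  compatibility with \<open>\<circ>\<close> gives \<open>a + \<lambda>\<^sub>a(b) \<approx> a' + \<lambda>\<^sub>a\<^sub>'(b) \<approx> a + \<lambda>\<^sub>a\<^sub>'(b)\<close>, and \<open>a\<close> cancels.\<close>

lemma lambda_M_eta:
  assumes aa: "(a, a') \<in> eta X r" and bb: "(b, b') \<in> eta X r"
  shows "(lambda_M X r a b, lambda_M X r a' b') \<in> eta X r"
proof -
  note a = eta_closed[OF aa] and b = eta_closed[OF bb]
  have "(a \<otimes>\<^bsub>M_circ X r\<^esub> b', a' \<otimes>\<^bsub>M_circ X r\<^esub> b') \<in> eta X r"
    by (rule monoid_congruenceD(5)[OF eta_circ aa eta_facts(2)[OF b(2)]])
  then have 1: "(a \<otimes>\<^bsub>M_add X r\<^esub> lambda_M X r a b', a' \<otimes>\<^bsub>M_add X r\<^esub> lambda_M X r a' b') \<in> eta X r"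
    by (simp only: M_circ_add a b)
  have 2: "(a' \<otimes>\<^bsub>M_add X r\<^esub> lambda_M X r a' b', a \<otimes>\<^bsub>M_add X r\<^esub> lambda_M X r a' b') \<in> eta X r"
    by (rule eta_facts(5)[OF eta_facts(3)[OF aa] eta_facts(2)[OF lambda_M_closed[OF a(2) b(2)]]])
  have "(lambda_M X r a b', lambda_M X r a' b') \<in> eta X r"
    by (rule eta_cancel[OF a(1) lambda_M_closed[OF a(1) b(2)] lambda_M_closed[OF a(2) b(2)]
      eta_facts(4)[OF 1 2]])
  moreover have "(lambda_M X r a b, lambda_M X r a b') \<in> eta X r"
    by (rule eta_hom[OF auto_hom[OF lambda_M_auto[OF a(1)]] bb])
  ultimately show ?thesis using eta_facts(4) by blast
qed

lemma lambda_bar_bar: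
  assumes a: "a \<in> carrier (M_add X r)" and b: "b \<in> carrier (M_add X r)"
  shows "lambda_bar X r (bar a) (bar b) = bar (lambda_M X r a b)"
proof -
  have "bar (lambda_M X r a' b') = bar (lambda_M X r a b)" if "a' \<in> bar a" "b' \<in> bar b" for a' b'
    using that by (intro bar_eqI[symmetric] lambda_M_eta) simp_all
  moreover have "a \<in> bar a" "b \<in> bar b" using eta_facts(2) a b by simp_all
  ultimately have "(\<Union>a' \<in> bar a. \<Union>b' \<in> bar b. bar (lambda_M X r a' b')) = bar (lambda_M X r a b)"
    by blast
  then show ?thesis using bar_closed[OF b] by (simp add: lambda_bar_def)
qed

lemma lambda_bar_auto:
  assumes "A \<in> carrier (Mbar_add X r)"
  shows "lambda_bar X r A \<in> auto (Mbar_add X r)"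
proof -
  obtain a where a: "a \<in> carrier (M_add X r)" "A = bar a" using assms by (rule bar_cases)
  note auto = lambda_M_auto[OF a(1)]
  note closed = lambda_M_closed[OF a(1)]
  have add: "b \<otimes>\<^bsub>M_add X r\<^esub> c \<in> carrier (M_add X r)"
    if "b \<in> carrier (M_add X r)" "c \<in> carrier (M_add X r)" for b c
    by (rule monoid.m_closed[OF M_add_monoid that])
  have "lambda_bar X r A \<in> hom (Mbar_add X r) (Mbar_add X r)"
  proof (rule homI)
    fix B C assume "B \<in> carrier (Mbar_add X r)"
    then obtain b where b: "b \<in> carrier (M_add X r)" "B = bar b" by (rule bar_cases)
    show "lambda_bar X r A B \<in> carrier (Mbar_add X r)"
      unfolding a(2) b(2) lambda_bar_bar[OF a(1) b(1)] by (rule bar_closed[OF closed[OF b(1)]])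
    assume "C \<in> carrier (Mbar_add X r)"
    then obtain c where c: "c \<in> carrier (M_add X r)" "C = bar c" by (rule bar_cases)
    show "lambda_bar X r A (B \<otimes>\<^bsub>Mbar_add X r\<^esub> C) =
        lambda_bar X r A B \<otimes>\<^bsub>Mbar_add X r\<^esub> lambda_bar X r A C"
      unfolding a(2) b(2) c(2) bar_add[OF b(1) c(1)] lambda_bar_bar[OF a(1) b(1)]
        lambda_bar_bar[OF a(1) c(1)] lambda_bar_bar[OF a(1) add[OF b(1) c(1)]]
        bar_add[OF closed[OF b(1)] closed[OF c(1)]] hom_mult[OF auto_hom[OF auto] b(1) c(1)] ..
  qed
  moreover have "bij_betw (lambda_bar X r A) (carrier (Mbar_add X r)) (carrier (Mbar_add X r))"
    unfolding bij_betw_def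
  proof
    show "inj_on (lambda_bar X r A) (carrier (Mbar_add X r))"
    proof (rule inj_onI)
      fix B C assume B: "B \<in> carrier (Mbar_add X r)" and C: "C \<in> carrier (Mbar_add X r)"
        and eq: "lambda_bar X r A B = lambda_bar X r A C"
      obtain b where b: "b \<in> carrier (M_add X r)" "B = bar b" using B by (rule bar_cases)
      obtain c where c: "c \<in> carrier (M_add X r)" "C = bar c" using C by (rule bar_cases)
      have "bar (lambda_M X r a b) = bar (lambda_M X r a c)"
        using eq unfolding a(2) b(2) c(2) lambda_bar_bar[OF a(1) b(1)] lambda_bar_bar[OF a(1) c(1)] .
      then have "(lambda_M X r a b, lambda_M X r a c) \<in> eta X r"
        by (rule bar_eq_iff[OF closed[OF b(1)] closed[OF c(1)], THEN iffD1])
      \<comment> \<open>The inverse automorphism of \<open>M\<close> preserves \<open>eta\<close> as well.\<close>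
      then have "(restrict (inv_into (carrier (M_add X r)) (lambda_M X r a)) (carrier (M_add X r)) (lambda_M X r a b),
          restrict (inv_into (carrier (M_add X r)) (lambda_M X r a)) (carrier (M_add X r)) (lambda_M X r a c)) \<in> eta X r"
        by (rule eta_hom[OF auto_inv_hom[OF M_add_monoid auto]])
      then have "(b, c) \<in> eta X r"
        by (simp add: closed b(1) c(1) inv_into_f_f[OF bij_betw_imp_inj_on[OF auto_bij[OF auto]]])
      then show "B = C" unfolding b(2) c(2) by (rule bar_eqI)
    qed
    show "lambda_bar X r A ` carrier (Mbar_add X r) = carrier (Mbar_add X r)"
    proof -
      have "lambda_bar X r A ` carrier (Mbar_add X r) = bar ` lambda_M X r a ` carrier (M_add X r)"
        unfolding carrier_Mbar_add image_image a(2) by (rule image_cong[OF refl lambda_bar_bar[OF a(1)]])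
      also have "lambda_M X r a ` carrier (M_add X r) = carrier (M_add X r)"
        by (rule bij_betw_imp_surj_on[OF auto_bij[OF auto]])
      finally show ?thesis unfolding carrier_Mbar_add .
    qed
  qed
  moreover have "lambda_bar X r A \<in> extensional (carrier (Mbar_add X r))"
    by (simp add: lambda_bar_def)
  ultimately show ?thesis by (simp add: auto_def Bij_def)
qed

lemma Mbar_circ_add:
  assumes "A \<in> carrier (Mbar_add X r)" "B \<in> carrier (Mbar_add X r)"
  shows "A \<otimes>\<^bsub>Mbar_circ X r\<^esub> B = A \<otimes>\<^bsub>Mbar_add X r\<^esub> lambda_bar X r A B"
proof -
  obtain a where a: "a \<in> carrier (M_add X r)" "A = bar a" using assms(1) by (rule bar_cases)
  obtain b where b: "b \<in> carrier (M_add X r)" "B = bar b" using assms(2) by (rule bar_cases)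
  show ?thesis
    unfolding a(2) b(2) bar_circ[OF a(1) b(1)] lambda_bar_bar[OF a(1) b(1)]
      bar_add[OF a(1) lambda_M_closed[OF a(1) b(1)]] M_circ_add[OF a(1) b(1)] ..
qed

lemma lambda_bar_circ:
  assumes "A \<in> carrier (Mbar_add X r)" "B \<in> carrier (Mbar_add X r)" "C \<in> carrier (Mbar_add X r)"
  shows "lambda_bar X r (A \<otimes>\<^bsub>Mbar_circ X r\<^esub> B) C = lambda_bar X r A (lambda_bar X r B C)"
proof -
  obtain a where a: "a \<in> carrier (M_add X r)" "A = bar a" using assms(1) by (rule bar_cases)
  obtain b where b: "b \<in> carrier (M_add X r)" "B = bar b" using assms(2) by (rule bar_cases)
  obtain c where c: "c \<in> carrier (M_add X r)" "C = bar c" using assms(3) by (rule bar_cases)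
  have ab: "a \<otimes>\<^bsub>M_circ X r\<^esub> b \<in> carrier (M_add X r)"
    using monoid.m_closed[OF M_circ_monoid] a(1) b(1) by simp
  show ?thesis
    unfolding a(2) b(2) c(2) bar_circ[OF a(1) b(1)] lambda_bar_bar[OF ab c(1)]
      lambda_bar_bar[OF b(1) c(1)] lambda_bar_bar[OF a(1) lambda_M_closed[OF b(1) c(1)]]
      lambda_M_circ[OF a(1) b(1) c(1)] ..
qed

lemma lambda_bar_hom: "lambda_bar X r \<in> hom (Mbar_circ X r) (AutoGroup (Mbar_add X r))"
proof (rule homI)
  fix A B assume "A \<in> carrier (Mbar_circ X r)" "B \<in> carrier (Mbar_circ X r)"
  then have A: "A \<in> carrier (Mbar_add X r)" and B: "B \<in> carrier (Mbar_add X r)"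
    by (simp_all only: carrier_Mbar_circ)
  show "lambda_bar X r A \<in> carrier (AutoGroup (Mbar_add X r))"
    unfolding carrier_AutoGroup by (rule lambda_bar_auto[OF A])
  show "lambda_bar X r (A \<otimes>\<^bsub>Mbar_circ X r\<^esub> B) =
      lambda_bar X r A \<otimes>\<^bsub>AutoGroup (Mbar_add X r)\<^esub> lambda_bar X r B"
    unfolding mult_AutoGroup[OF lambda_bar_auto[OF A] lambda_bar_auto[OF B]]
  proof (rule extensionalityI)
    show "lambda_bar X r (A \<otimes>\<^bsub>Mbar_circ X r\<^esub> B) \<in> extensional (carrier (Mbar_add X r))"
      by (simp add: lambda_bar_def)
    fix C assume "C \<in> carrier (Mbar_add X r)"
    then show "lambda_bar X r (A \<otimes>\<^bsub>Mbar_circ X r\<^esub> B) C =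
        compose (carrier (Mbar_add X r)) (lambda_bar X r A) (lambda_bar X r B) C"
      by (simp only: compose_eq lambda_bar_circ[OF A B])
  qed (rule compose_extensional)
qed

sublocale Mbar: left_cancellative_truss "Mbar_add X r" "lambda_bar X r"
proof (intro left_cancellative_truss.intro left_cancellative_truss_axioms.intro)
  show "monoid (Mbar_add X r)" by (rule Mbar_add_monoid)
  have "left_cancellative (Mbar_add X r)"
    unfolding Mbar_add_def eta_def by (rule left_cancellative_congruence_least(2)[OF M_add_monoid])
  then show "\<And>a b c. \<lbrakk>a \<in> carrier (Mbar_add X r); b \<in> carrier (Mbar_add X r);
      c \<in> carrier (Mbar_add X r); a \<otimes>\<^bsub>Mbar_add X r\<^esub> b = a \<otimes>\<^bsub>Mbar_add X r\<^esub> c\<rbrakk> \<Longrightarrow> b = c"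
    unfolding left_cancellative_def by blast
  show "lambda_bar X r A \<in> auto (Mbar_add X r)" if "A \<in> carrier (Mbar_add X r)" for A
    by (rule lambda_bar_auto[OF that])
  show "lambda_bar X r (A \<otimes>\<^bsub>Mbar_add X r\<^esub> lambda_bar X r A B) C = lambda_bar X r A (lambda_bar X r B C)"
    if "A \<in> carrier (Mbar_add X r)" "B \<in> carrier (Mbar_add X r)" "C \<in> carrier (Mbar_add X r)" for A B C
    using lambda_bar_circ[OF that] unfolding Mbar_circ_add[OF that(1,2)] .
  show "\<exists>C \<in> carrier (Mbar_add X r). A \<otimes>\<^bsub>Mbar_add X r\<^esub> B = B \<otimes>\<^bsub>Mbar_add X r\<^esub> C"
    if AB: "A \<in> carrier (Mbar_add X r)" "B \<in> carrier (Mbar_add X r)" for A B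
  proof -
    obtain a where a: "a \<in> carrier (M_add X r)" "A = bar a" using AB(1) by (rule bar_cases)
    obtain b where b: "b \<in> carrier (M_add X r)" "B = bar b" using AB(2) by (rule bar_cases)
    obtain c where c: "c \<in> carrier (M_add X r)" "a \<otimes>\<^bsub>M_add X r\<^esub> b = b \<otimes>\<^bsub>M_add X r\<^esub> c"
      using M_normal[OF a(1) b(1)] by blast
    have "A \<otimes>\<^bsub>Mbar_add X r\<^esub> B = B \<otimes>\<^bsub>Mbar_add X r\<^esub> bar c"
      unfolding a(2) b(2) bar_add[OF a(1) b(1)] bar_add[OF b(1) c(1)] c(2) ..
    with bar_closed[OF c(1)] show ?thesis by blast
  qed
qed

lemma r_bar_braid: "r_bar X r = Mbar.braid"
  unfolding r_bar_def Mbar.braid_def c_bar_def Mbar.conj_elt_def ..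

lemma Mbar_left_semi_truss:
  "left_semi_truss (carrier (Mbar_add X r)) (mult (Mbar_add X r)) (mult (Mbar_circ X r)) (phi_bar X r)"
proof -
  interpret C: monoid "Mbar_circ X r" by (rule Mbar_circ_monoid)
  have "semigroup_on (carrier (Mbar_add X r)) (mult (Mbar_add X r))"
    using Mbar.one_closed by (auto simp: semigroup_on_def Mbar.m_assoc)
  moreover have "semigroup_on (carrier (Mbar_add X r)) (mult (Mbar_circ X r))"
    using C.one_closed C.m_closed C.m_assoc by (auto simp: semigroup_on_def carrier_Mbar_circ)
  moreover have "a \<otimes>\<^bsub>Mbar_circ X r\<^esub> (b \<otimes>\<^bsub>Mbar_add X r\<^esub> c) =
      a \<otimes>\<^bsub>Mbar_circ X r\<^esub> b \<otimes>\<^bsub>Mbar_add X r\<^esub> lambda_bar X r a c"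
    if "a \<in> carrier (Mbar_add X r)" "b \<in> carrier (Mbar_add X r)" "c \<in> carrier (Mbar_add X r)" for a b c
    using that by (simp add: Mbar_circ_add hom_mult[OF Mbar.lam_hom] Mbar.m_assoc)
  ultimately show ?thesis by (auto simp: left_semi_truss_def phi_bar_def)
qed

definition gen_bar :: "'a \<Rightarrow> 'a list set set" where
  "gen_bar x = bar (derived_gen X r x)"

lemma gen_bar_closed: "x \<in> X \<Longrightarrow> gen_bar x \<in> carrier (Mbar_add X r)"
  unfolding gen_bar_def by (intro bar_closed derived_gen_closed)

lemma lambda_bar_gen: "x \<in> X \<Longrightarrow> y \<in> X \<Longrightarrow> lambda_bar X r (gen_bar x) (gen_bar y) = gen_bar (sig r x y)"
  by (simp only: gen_bar_def lambda_bar_bar derived_gen_closed lambda_M_gen)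

text \<open>The derived relation of the letters \<open>x\<close> and \<open>y\<close> exhibits \<open>\<sigma>\<^bsub>\<sigma>\<^sub>x(y)\<^esub>(\<gamma>\<^sub>y(x))\<close> as the conjugate of \<open>x\<close> past
  \<open>\<sigma>\<^sub>x(y)\<close>.\<close>

lemma r_bar_gen:
  assumes x: "x \<in> X" and y: "y \<in> X"
  shows "r_bar X r (gen_bar x, gen_bar y) = (gen_bar (sig r x y), gen_bar (gam r y x))"
proof -
  have s: "sig r x y \<in> X" and g: "gam r y x \<in> X" using x y by simp_all
  have "Mbar.gamma (gen_bar y) (gen_bar x) = gen_bar (gam r y x)"
  proof (rule Mbar.gamma_eqI)
    show "gen_bar x \<otimes>\<^bsub>Mbar_add X r\<^esub> lambda_bar X r (gen_bar x) (gen_bar y) =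
      lambda_bar X r (gen_bar x) (gen_bar y) \<otimes>\<^bsub>Mbar_add X r\<^esub>
        lambda_bar X r (lambda_bar X r (gen_bar x) (gen_bar y)) (gen_bar (gam r y x))"
      unfolding lambda_bar_gen[OF x y] lambda_bar_gen[OF s g]
      unfolding gen_bar_def
      by (simp only: bar_add derived_gen_closed x s sig_closed g M_add_gen[OF x y])
  qed (intro gen_bar_closed x y g)+
  then show ?thesis unfolding r_bar_braid Mbar.braid_gamma lambda_bar_gen[OF x y] by simp
qed

lemma X_bar_gen: "X_bar X r = gen_bar ` X"
  by (simp add: X_bar_def gen_bar_def)

lemma X_bar_solution: "ybe_solution (X_bar X r) (restrict (r_bar X r) (X_bar X r \<times> X_bar X r))"
proof (rule ybe_solution_restrict)
  show "ybe_solution (carrier (Mbar_add X r)) (r_bar X r)"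
    unfolding r_bar_braid by (rule Mbar.braid_solution)
  show "X_bar X r \<subseteq> carrier (Mbar_add X r)" unfolding X_bar_gen using gen_bar_closed by blast
  show "X_bar X r \<noteq> {}" using solution by (simp add: X_bar_gen ybe_solution_def)
  show "r_bar X r \<in> X_bar X r \<times> X_bar X r \<rightarrow> X_bar X r \<times> X_bar X r"
    unfolding X_bar_gen
  proof (rule funcsetI)
    fix t assume "t \<in> gen_bar ` X \<times> gen_bar ` X"
    then obtain x y where "x \<in> X" "y \<in> X" "t = (gen_bar x, gen_bar y)" by blast
    then show "r_bar X r t \<in> gen_bar ` X \<times> gen_bar ` X" by (simp add: r_bar_gen)
  qed
qed

lemma X_bar_nondegenerate:
  "left_nondegenerate (X_bar X r) (restrict (r_bar X r) (X_bar X r \<times> X_bar X r))"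
  unfolding left_nondegenerate_def
proof
  fix A assume A: "A \<in> X_bar X r"
  then obtain x where x: "x \<in> X" "A = gen_bar x" unfolding X_bar_gen by blast
  have sub: "gen_bar ` X \<subseteq> carrier (Mbar_add X r)" using gen_bar_closed by blast
  have "lambda_bar X r A ` gen_bar ` X = gen_bar ` sig r x ` X"
    unfolding image_image x(2) by (rule image_cong[OF refl lambda_bar_gen[OF x(1)]])
  also have "sig r x ` X = X" by (rule bij_betw_imp_surj_on[OF sig_bij[OF x(1)]])
  finally have "bij_betw (lambda_bar X r A) (X_bar X r) (X_bar X r)"
    unfolding bij_betw_def X_bar_gen x(2)
    using inj_on_subset[OF bij_betw_imp_inj_on[OF Mbar.lam_bij[OF gen_bar_closed[OF x(1)]]] sub]
    by simp
  moreover have "sig (restrict (r_bar X r) (X_bar X r \<times> X_bar X r)) A B = lambda_bar X r A B"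
    if "B \<in> X_bar X r" for B
    using A that by (simp add: sig_def r_bar_def)
  ultimately show "bij_betw (sig (restrict (r_bar X r) (X_bar X r \<times> X_bar X r)) A) (X_bar X r) (X_bar X r)"
    by (simp cong: bij_betw_cong)
qed

end

theorem corollary5p9:
  fixes X :: "'a set" and r :: "'a \<times> 'a \<Rightarrow> 'a \<times> 'a"
  assumes "ybe_solution X r" and "left_nondegenerate X r"
    and eta_circ: "monoid_congruence (M_circ X r) (eta X r)"
  shows
    "left_semi_truss (carrier (Mbar_add X r)) (mult (Mbar_add X r)) (mult (Mbar_circ X r))
       (phi_bar X r) \<and>
     (\<forall>a \<in> carrier (Mbar_add X r).
        carrier (Mbar_add X r) #>\<^bsub>Mbar_add X r\<^esub> a \<subseteq> a <#\<^bsub>Mbar_add X r\<^esub> carrier (Mbar_add X r)) \<and>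
     lambda_bar X r \<in> hom (Mbar_circ X r) (AutoGroup (Mbar_add X r)) \<and>
     (\<forall>a \<in> carrier (Mbar_add X r). \<forall>b \<in> carrier (Mbar_add X r).
        a \<otimes>\<^bsub>Mbar_circ X r\<^esub> b = a \<otimes>\<^bsub>Mbar_add X r\<^esub> lambda_bar X r a b) \<and>
     (\<forall>a \<in> carrier (Mbar_add X r). \<forall>b \<in> carrier (Mbar_add X r).
        \<exists>!c. c \<in> carrier (Mbar_add X r) \<and>
             a \<otimes>\<^bsub>Mbar_add X r\<^esub> b = b \<otimes>\<^bsub>Mbar_add X r\<^esub> c) \<and>
     ybe_solution (carrier (Mbar_add X r)) (r_bar X r) \<and>
     left_nondegenerate (carrier (Mbar_add X r)) (r_bar X r) \<and>
     ybe_solution (X_bar X r) (restrict (r_bar X r) (X_bar X r \<times> X_bar X r)) \<and>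
     left_nondegenerate (X_bar X r) (restrict (r_bar X r) (X_bar X r \<times> X_bar X r))"
proof -
  interpret lnd_quotient X r
    by unfold_locales (rule assms)+
  have "carrier (Mbar_add X r) #>\<^bsub>Mbar_add X r\<^esub> a \<subseteq> a <#\<^bsub>Mbar_add X r\<^esub> carrier (Mbar_add X r)"
    if "a \<in> carrier (Mbar_add X r)" for a
    using Mbar.normal[OF _ that] unfolding r_coset_def l_coset_def by fast
  then show ?thesis
    by (intro conjI ballI Mbar_left_semi_truss lambda_bar_hom Mbar_circ_add Mbar.ex1_conjugate
        Mbar.braid_solution[folded r_bar_braid] Mbar.braid_nondegenerate[folded r_bar_braid]
        X_bar_solution X_bar_nondegenerate) assumption+
qed

end
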